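(* Let $\lambda,\mu,\nu\in\mathbb{R}$ be pairwise distinct and $\mathfrak{p}=\{(\lambda,2),(\mu,2),(\nu,3)\}$. Then the set of all block diagonal matrices $$\operatorname{diag}(\nu\mathbb{I}_2,A,\mu,B),\qquad A=R_\alpha^{-1}\begin{pmatrix}\nu&0\\0&\lambda\end{pmatrix}R_\alpha,\quad B=R_\theta^{-1}\begin{pmatrix}\lambda&0\\0&\mu\end{pmatrix}R_\theta,$$ with $(\alpha,\theta)\in\left(\left]0,\frac{\pi}{2}\right]\times\left[0,\frac{\pi}{2}\right]\right)\cup\{(0,0)\}$, is a cross-section for $\mathrm{Sym}_{\mathfrak{p}}/\mathcal{G}_2$.
   Context: $R_\alpha=\begin{pmatrix}\cos\alpha&-\sin\alpha\\ \sin\alpha&\cos\alpha\end{pmatrix}$; $\operatorname{diag}(\cdot)$ denotes the block diagonal matrix with the listed blocks; $]a,b]$ denotes a half-open interval. Let $V$ be a 7-dimensional Euclidean space with a vector product $\pi$, i.e. a linear map $\pi:V\wedge V\to V$ such that $\{u,v,\pi(u\wedge v)\}$ is orthonormal whenever $\{u,v\}\subset V$ is. Write $xy=\pi(x\wedge y)$. Let $\mathcal{G}_2=\mathrm{Aut}(\pi)$ be the group of all orthogonal linear maps $g:V\to V$ with $g(xy)=g(x)g(y)$ for all $x,y\in V$. A Cayley triple is a triple $(u,v,z)\in V^3$ such that $\{u,v,uv,z\}$ is orthonormal; it determines an orthonormal basis $(u,v,uv,z,uz,vz,(uv)z)$ of $V$. Fix a Cayley triple $s$, and for a symmetric endomorphism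 $\delta$ of $V$ let $[\delta]_s$ be its matrix in the basis determined by $s$; $\delta\mapsto[\delta]_s$ is a bijection $\mathrm{Sym}(V)\to\mathrm{Sym}(\mathbb{R}^7)$ from symmetric endomorphisms of $V$ to real symmetric $7\times7$-matrices. $\mathcal{G}_2$ acts on $\mathrm{Sym}(\mathbb{R}^7)$ by $[\delta]_s\cdot g=[g^{-1}\delta g]_s$. For a symmetric matrix $\delta$ let $\mathfrak{p}(\delta)=\{(\lambda,\dim\mathcal{E}_\lambda(\delta))\mid\lambda\text{ an eigenvalue of }\delta\}$, where $\mathcal{E}_\lambda(\delta)$ is the eigenspace of $\lambda$, and for a set $\mathfrak{p}$ of such pairs let $\mathrm{Sym}_{\mathfrak{p}}=\{\delta\in\mathrm{Sym}(\mathbb{R}^7)\mid\mathfrak{p}(\delta)=\mathfrak{p}\}$, which is invariant under the action. A cross-section for $\mathrm{Sym}_{\mathfrak{p}}/\mathcal{G}_2$ is a subset of $\mathrm{Sym}_{\mathfrak{p}}$ containing exactly one element of each $\mathcal{G}_2$-orbit. $\mathbb{I}_n$ is the $n\times n$ identity matrix. *)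

theory Defs
  imports "HOL-Analysis.Analysis"
begin

text \<open>
  Lists rather than sets, so that orthonormality includes distinctness of the listed vectors.
\<close>

definition orthonormal :: "'a::real_inner list \<Rightarrow> bool" where
  "orthonormal xs \<longleftrightarrow>
     (\<forall>i<length xs. \<forall>j<length xs. xs ! i \<bullet> xs ! j = (if i = j then 1 else 0))"

text \<open>
  A linear map from the exterior square of \<open>V\<close> to \<open>V\<close> is encoded, by the universal property,
  as an alternating bilinear map \<open>V \<Rightarrow> V \<Rightarrow> V\<close>.
\<close>

definition vector_product :: "('a::euclidean_space \<Rightarrow> 'a \<Rightarrow> 'a) \<Rightarrow> bool" where
  "vector_product prd \<longleftrightarrow>
     bilinear prd \<and> (\<forall>x. prd x x = 0) \<and>
     (\<forall>u v. orthonormal [u, v] \<longrightarrow> orthonormal [u, v, prd u v])"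

definition G2 :: "('a::euclidean_space \<Rightarrow> 'a \<Rightarrow> 'a) \<Rightarrow> ('a \<Rightarrow> 'a) set" where
  "G2 prd = {g. orthogonal_transformation g \<and> (\<forall>x y. g (prd x y) = prd (g x) (g y))}"

definition cayley_triple ::
    "('a::euclidean_space \<Rightarrow> 'a \<Rightarrow> 'a) \<Rightarrow> 'a \<times> 'a \<times> 'a \<Rightarrow> bool" where
  "cayley_triple prd = (\<lambda>(u, v, z). orthonormal [u, v, prd u v, z])"

text \<open>
  The index type \<open>7\<close> consists of the residues modulo 7.  As usual with \<^const>\<open>vector\<close>, list
  positions are numbered \<open>1, \<dots>, 7\<close>, where the last index \<open>7\<close> equals \<open>0\<close>; likewise
  \<open>2 = 0\<close> is the last index of the type \<open>2\<close>.
\<close>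

definition cayley_basis ::
    "('a::euclidean_space \<Rightarrow> 'a \<Rightarrow> 'a) \<Rightarrow> 'a \<times> 'a \<times> 'a \<Rightarrow> 'a ^ 7" where
  "cayley_basis prd = (\<lambda>(u, v, z).
     vector [u, v, prd u v, z, prd u z, prd v z, prd (prd u v) z])"

definition sym_endo :: "('a::euclidean_space \<Rightarrow> 'a) set" where
  "sym_endo = {\<delta>. linear \<delta> \<and> (\<forall>x y. \<delta> x \<bullet> y = x \<bullet> \<delta> y)}"

definition matrix_in_basis :: "'a::euclidean_space ^ 7 \<Rightarrow> ('a \<Rightarrow> 'a) \<Rightarrow> real ^ 7 ^ 7" where
  "matrix_in_basis b \<delta> = (\<chi> i j. representation (range (($) b)) (\<delta> (b $ j)) (b $ i))"

text \<open>
  The orbit of a symmetric matrix \<open>M\<close> under the right action sending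
  \<open>(matrix_in_basis b \<delta>, g)\<close> to \<open>matrix_in_basis b (g\<^sup>-\<^sup>1 \<delta> g)\<close>, where \<open>b\<close> is the basis
  determined by \<open>s\<close>.
\<close>

definition G2_orbit ::
    "('a::euclidean_space \<Rightarrow> 'a \<Rightarrow> 'a) \<Rightarrow> 'a \<times> 'a \<times> 'a \<Rightarrow> real ^ 7 ^ 7 \<Rightarrow> (real ^ 7 ^ 7) set" where
  "G2_orbit prd s M =
     {matrix_in_basis (cayley_basis prd s) (inv g \<circ> \<delta> \<circ> g) | \<delta> g.
        \<delta> \<in> sym_endo \<and> matrix_in_basis (cayley_basis prd s) \<delta> = M \<and> g \<in> G2 prd}"

definition eigenspace :: "real ^ 'n ^ 'n \<Rightarrow> real \<Rightarrow> (real ^ 'n) set" where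
  "eigenspace M l = {x. M *v x = l *\<^sub>R x}"

definition eigenvalue :: "real ^ 'n ^ 'n \<Rightarrow> real \<Rightarrow> bool" where
  "eigenvalue M l \<longleftrightarrow> (\<exists>x. x \<noteq> 0 \<and> M *v x = l *\<^sub>R x)"

definition eigen_dims :: "real ^ 'n ^ 'n \<Rightarrow> (real \<times> nat) set" where
  "eigen_dims M = {(l, dim (eigenspace M l)) | l. eigenvalue M l}"

definition Sym :: "(real \<times> nat) set \<Rightarrow> (real ^ 7 ^ 7) set" where
  "Sym p = {M. transpose M = M \<and> eigen_dims M = p}"

definition cross_section ::
    "('a::euclidean_space \<Rightarrow> 'a \<Rightarrow> 'a) \<Rightarrow> 'a \<times> 'a \<times> 'a \<Rightarrow> (real \<times> nat) set \<Rightarrow>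
     (real ^ 7 ^ 7) set \<Rightarrow> bool" where
  "cross_section prd s p C \<longleftrightarrow>
     C \<subseteq> Sym p \<and> (\<forall>orb \<in> G2_orbit prd s ` Sym p. \<exists>!N. N \<in> C \<inter> orb)"

definition rot :: "real \<Rightarrow> real ^ 2 ^ 2" where
  "rot \<alpha> = vector [vector [cos \<alpha>, - sin \<alpha>], vector [sin \<alpha>, cos \<alpha>]]"

definition diag2 :: "real \<Rightarrow> real \<Rightarrow> real ^ 2 ^ 2" where
  "diag2 a d = vector [vector [a, 0], vector [0, d]]"

definition block_diag ::
    "real ^ 2 ^ 2 \<Rightarrow> real ^ 2 ^ 2 \<Rightarrow> real \<Rightarrow> real ^ 2 ^ 2 \<Rightarrow> real ^ 7 ^ 7" where
  "block_diag X A m B = vector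
     [vector [X$1$1, X$1$2, 0,     0,     0, 0,     0    ],
      vector [X$2$1, X$2$2, 0,     0,     0, 0,     0    ],
      vector [0,     0,     A$1$1, A$1$2, 0, 0,     0    ],
      vector [0,     0,     A$2$1, A$2$2, 0, 0,     0    ],
      vector [0,     0,     0,     0,     m, 0,     0    ],
      vector [0,     0,     0,     0,     0, B$1$1, B$1$2],
      vector [0,     0,     0,     0,     0, B$2$1, B$2$2]]"

end

theory Submission
  imports Defs
begin

text \<open>
  Write \<open>N\<close>, \<open>L\<close>, \<open>M\<close> for the eigenspaces of a symmetric endomorphism \<open>\<delta>\<close> belonging to \<open>\<nu>\<close>, \<open>lam\<close>, \<open>\<mu>\<close>;
  they are mutually orthogonal of dimensions 3, 2, 2.  Products of vectors of a Cayley basis are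
  given by one table of signs, so any two Cayley triples are related by an element of \<open>G2\<close>.  Hence
  the orbit of the matrix of \<open>\<delta>\<close> consists of the matrices of \<open>\<delta>\<close> in all Cayley bases, and the claim
  says that exactly one of them is of the given block form (\<open>G2_orbit_eq\<close>).  The block form with
  parameters \<open>\<alpha>\<close>, \<open>\<theta>\<close> means that the Cayley basis, after rotating its third and fourth vectors by
  \<open>\<alpha>\<close> and its last two by \<open>\<theta>\<close>, consists of eigenvectors (\<open>matrix_eq_normal_form_iff\<close>).
  
  Existence (\<open>ex_adapted\<close>).  The three products of a basis of \<open>N\<close> span at most three dimensions, so
  some unit vector \<open>d\<close> is orthogonal to \<open>N\<close> and to all products of elements of \<open>N\<close>.  Then
  multiplication by \<open>d\<close> maps \<open>N\<close> isometrically into the orthogonal complement \<open>L \<oplus> M\<close> of \<open>N\<close>.  Counting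
  dimensions yields unit vectors \<open>w\<close>, \<open>v\<close> in \<open>N\<close> with \<open>d w \<in> L\<close> and \<open>d v \<in> M\<close>; they are automatically
  orthogonal.  Complete them by \<open>u\<close> to an orthonormal basis of \<open>N\<close> and put \<open>z = d (u v)\<close>.  In the Cayley
  basis of \<open>(u, v, z)\<close> one finds \<open>u z = d v\<close>, \<open>v z = - d u\<close>, \<open>(u v) z = d\<close>, so that \<open>w\<close> lies in the
  plane of \<open>u v\<close> and \<open>z\<close>, and \<open>d w\<close> is \<open>w\<close> turned by a right angle in that plane.  The position of
  \<open>w\<close> gives \<open>\<alpha>\<close>; what is left of \<open>L\<close> and \<open>M\<close> is a pair of orthogonal lines in the plane of \<open>v z\<close> and \<open>(u v) z\<close>,
  whose angle is \<open>\<theta>\<close>.  Changing signs of \<open>u\<close>, \<open>d\<close> and of the pair \<open>(u, v)\<close> brings both angles into the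
  first quadrant.  If \<open>\<alpha> = 0\<close>, then \<open>N\<close> is closed under the product, \<open>d\<close> may be any unit vector
  orthogonal to \<open>N\<close>, and choosing it in \<open>M\<close> forces \<open>\<theta> = 0\<close>.
  
  Uniqueness (\<open>normal_form_parameters_unique\<close>).  The form \<open>(x y) \<bullet> t\<close> is alternating, so its maximum on
  orthonormal triples of \<open>N\<close> is an invariant of \<open>N\<close>, and it equals \<open>cos \<alpha>\<close>.  If \<open>\<alpha> > 0\<close>, then \<open>d\<close> is
  determined up to sign by \<open>N\<close>, and \<open>\<delta> d \<bullet> d = lam sin\<^sup>2 \<theta> + \<mu> cos\<^sup>2 \<theta>\<close> determines \<open>\<theta>\<close>.
\<close>

section \<open>The index type 7\<close>

lemma UNIV_7: "(UNIV :: 7 set) = {1, 2, 3, 4, 5, 6, 7}"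
proof -
  have "card {1, 2, 3, 4, 5, 6, 7 :: 7} = CARD(7)" by simp
  then show ?thesis by (metis card_subset_eq finite top_greatest)
qed

lemma forall_7: "(\<forall>i::7. P i) \<longleftrightarrow> P 1 \<and> P 2 \<and> P 3 \<and> P 4 \<and> P 5 \<and> P 6 \<and> P 7"
proof -
  have "(\<forall>i::7. P i) \<longleftrightarrow> (\<forall>i\<in>UNIV. P i)" by simp
  then show ?thesis unfolding UNIV_7 by blast
qed

lemma sum_7: "sum f (UNIV :: 7 set) = f 1 + f 2 + f 3 + f 4 + f 5 + f 6 + f 7"
  unfolding UNIV_7 by (simp add: add.assoc)

lemma vector_7:
  fixes a :: "'b::zero"
  shows "(vector [a, b, c, d, e, f, g] :: 'b ^ 7) $ 1 = a"
    and "(vector [a, b, c, d, e, f, g] :: 'b ^ 7) $ 2 = b"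
    and "(vector [a, b, c, d, e, f, g] :: 'b ^ 7) $ 3 = c"
    and "(vector [a, b, c, d, e, f, g] :: 'b ^ 7) $ 4 = d"
    and "(vector [a, b, c, d, e, f, g] :: 'b ^ 7) $ 5 = e"
    and "(vector [a, b, c, d, e, f, g] :: 'b ^ 7) $ 6 = f"
    and "(vector [a, b, c, d, e, f, g] :: 'b ^ 7) $ 7 = g"
  by (simp_all add: vector_def)

section \<open>Vector products\<close>

lemma orthonormal_2:
  "orthonormal [u, v] \<longleftrightarrow> u \<bullet> u = 1 \<and> v \<bullet> v = 1 \<and> u \<bullet> v = 0"
  by (auto simp: orthonormal_def less_Suc_eq numeral_2_eq_2 inner_commute)

lemma orthonormal_3:
  "orthonormal [u, v, w] \<longleftrightarrow> u \<bullet> u = 1 \<and> v \<bullet> v = 1 \<and> w \<bullet> w = 1 \<and>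
     u \<bullet> v = 0 \<and> u \<bullet> w = 0 \<and> v \<bullet> w = 0"
  by (auto simp: orthonormal_def less_Suc_eq numeral_eq_Suc inner_commute)

lemma orthonormal_4:
  "orthonormal [u, v, w, z] \<longleftrightarrow> u \<bullet> u = 1 \<and> v \<bullet> v = 1 \<and> w \<bullet> w = 1 \<and> z \<bullet> z = 1 \<and>
     u \<bullet> v = 0 \<and> u \<bullet> w = 0 \<and> v \<bullet> w = 0 \<and> u \<bullet> z = 0 \<and> v \<bullet> z = 0 \<and> w \<bullet> z = 0"
  by (auto simp: orthonormal_def less_Suc_eq numeral_eq_Suc inner_commute)

locale vector_product_space =
  fixes prd :: "'a::euclidean_space \<Rightarrow> 'a \<Rightarrow> 'a"  (infixl \<open>\<odot>\<close> 75)
  assumes vector_product: "vector_product (\<odot>)"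
begin

lemma bilinear_prd: "bilinear (\<odot>)"
  and prd_self [simp]: "x \<odot> x = 0"
  and orthonormal_prd: "orthonormal [u, v] \<Longrightarrow> orthonormal [u, v, u \<odot> v]"
  using vector_product by (auto simp: vector_product_def)

lemmas prd_linear =
  bilinear_ladd[OF bilinear_prd] bilinear_radd[OF bilinear_prd]
  bilinear_lsub[OF bilinear_prd] bilinear_rsub[OF bilinear_prd]
  bilinear_lmul[OF bilinear_prd] bilinear_rmul[OF bilinear_prd]
  bilinear_lneg[OF bilinear_prd] bilinear_rneg[OF bilinear_prd]
  bilinear_lzero[OF bilinear_prd] bilinear_rzero[OF bilinear_prd]

lemma prd_anticommute: "y \<odot> x = - (x \<odot> y)"
proof -
  have "(x + y) \<odot> (x + y) = x \<odot> y + y \<odot> x"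
    by (simp add: prd_linear del: prd_self) simp
  then have "x \<odot> y + y \<odot> x = 0" by simp
  then show ?thesis by (simp add: eq_neg_iff_add_eq_0 add.commute)
qed

text \<open>
  The defining property only speaks of orthonormal pairs.  Writing \<open>x\<close> and \<open>y\<close> as combinations of such
  a pair (Gram--Schmidt) turns it into the Gram determinant formula for all pairs; its polarisations
  below are what every later computation rests on.
\<close>

lemma prd_Gram:
  shows inner_prd_left: "(x \<odot> y) \<bullet> x = 0"
    and inner_prd_right: "(x \<odot> y) \<bullet> y = 0"
    and inner_prd_prd: "(x \<odot> y) \<bullet> (x \<odot> y) = (x \<bullet> x) * (y \<bullet> y) - (x \<bullet> y)\<^sup>2"
proof -
  have "(x \<odot> y) \<bullet> x = 0 \<and> (x \<odot> y) \<bullet> y = 0 \<and>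
      (x \<odot> y) \<bullet> (x \<odot> y) = (x \<bullet> x) * (y \<bullet> y) - (x \<bullet> y)\<^sup>2"
  proof (cases "x = 0")
    case True
    then show ?thesis by (simp add: prd_linear)
  next
    case False
    define u where "u = x /\<^sub>R norm x"
    have x: "x = norm x *\<^sub>R u" and uu: "u \<bullet> u = 1"
      using False by (simp_all add: u_def dot_square_norm power2_eq_square)
    define a where "a = norm x"
    define b where "b = y \<bullet> u"
    define y' where "y' = y - b *\<^sub>R u"
    define c where "c = norm y'"
    obtain v where y': "y' = c *\<^sub>R v" and v: "c = 0 \<or> v \<bullet> v = 1 \<and> u \<bullet> v = 0"
    proof (cases "y' = 0")
      case True
      then show ?thesis using that[of 0] by (simp add: c_def)
    next
      case nz: False
      have "u \<bullet> y' = 0" by (simp add: y'_def b_def inner_diff_right inner_commute uu)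
      then show ?thesis using that[of "y' /\<^sub>R c"] nz
        by (simp add: c_def dot_square_norm power2_eq_square)
    qed
    have y: "y = b *\<^sub>R u + c *\<^sub>R v" using y' by (simp add: y'_def algebra_simps)
    have x': "x = a *\<^sub>R u" using x by (simp add: a_def)
    from v show ?thesis
    proof
      assume "c = 0"
      then show ?thesis by (simp add: x' y prd_linear uu power2_eq_square)
    next
      assume "v \<bullet> v = 1 \<and> u \<bullet> v = 0"
      moreover from this have "orthonormal [u, v, u \<odot> v]"
        by (intro orthonormal_prd) (simp add: orthonormal_2 uu)
      ultimately show ?thesis unfolding x' y orthonormal_3
        by (simp add: prd_linear inner_add inner_commute power2_eq_square algebra_simps)
    qed
  qed
  then show "(x \<odot> y) \<bullet> x = 0" and "(x \<odot> y) \<bullet> y = 0"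
    and "(x \<odot> y) \<bullet> (x \<odot> y) = (x \<bullet> x) * (y \<bullet> y) - (x \<bullet> y)\<^sup>2" by auto
qed

lemma inner_prd_swap: "(x \<odot> y) \<bullet> z = - ((x \<odot> z) \<bullet> y)"
proof -
  have "(x \<odot> (y + z)) \<bullet> (y + z) = 0" by (rule inner_prd_right)
  then show ?thesis by (simp add: prd_linear inner_add inner_prd_right)
qed

lemma inner_prd_cycle: "(x \<odot> y) \<bullet> z = (y \<odot> z) \<bullet> x"
  using inner_prd_swap[of y x z] by (simp add: prd_anticommute[of y x])

lemma inner_prd_prd_left: "(x \<odot> y) \<bullet> (x \<odot> z) = (x \<bullet> x) * (y \<bullet> z) - (x \<bullet> y) * (x \<bullet> z)"
proof -
  have "(x \<odot> (y + z)) \<bullet> (x \<odot> (y + z)) = (x \<bullet> x) * ((y + z) \<bullet> (y + z)) - (x \<bullet> (y + z))\<^sup>2"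
    by (rule inner_prd_prd)
  then show ?thesis
    by (simp add: prd_linear inner_add inner_prd_prd power2_eq_square inner_commute algebra_simps)
qed

lemma prd_prd_same: "x \<odot> (x \<odot> y) = (x \<bullet> y) *\<^sub>R x - (x \<bullet> x) *\<^sub>R y"
proof (rule vector_eq_rdot[THEN iffD1, rule_format])
  fix z
  have "(x \<odot> (x \<odot> y)) \<bullet> z = - ((x \<odot> z) \<bullet> (x \<odot> y))" by (rule inner_prd_swap)
  also have "\<dots> = ((x \<bullet> y) *\<^sub>R x - (x \<bullet> x) *\<^sub>R y) \<bullet> z"
    by (simp add: inner_prd_prd_left inner_diff_left inner_commute algebra_simps)
  finally show "(x \<odot> (x \<odot> y)) \<bullet> z = ((x \<bullet> y) *\<^sub>R x - (x \<bullet> x) *\<^sub>R y) \<bullet> z" .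
qed

text \<open>
  Up to inner products, multiplications by \<open>x\<close> and \<open>y\<close> anticommute.  For orthogonal vectors this
  takes the place of associativity.
\<close>

lemma prd_prd_swap:
  "x \<odot> (y \<odot> z) = - (y \<odot> (x \<odot> z)) + (x \<bullet> z) *\<^sub>R y + (y \<bullet> z) *\<^sub>R x - (2 * (x \<bullet> y)) *\<^sub>R z"
proof -
  have "(x + y) \<odot> ((x + y) \<odot> z) = ((x + y) \<bullet> z) *\<^sub>R (x + y) - ((x + y) \<bullet> (x + y)) *\<^sub>R z"
    by (rule prd_prd_same)
  then have "x \<odot> (y \<odot> z) + y \<odot> (x \<odot> z) =
      (x \<bullet> z) *\<^sub>R y + (y \<bullet> z) *\<^sub>R x - (2 * (x \<bullet> y)) *\<^sub>R z"
    by (simp add: prd_linear inner_add prd_prd_same inner_commute algebra_simps)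
  then show ?thesis by (simp add: algebra_simps)
qed

text \<open>
  The products of the vectors of a Cayley basis are the same signed basis vectors for every Cayley
  triple.  The entries follow from \<open>prd_prd_same\<close> and \<open>prd_prd_swap\<close>, since all inner products of
  the vectors involved are known.
\<close>

lemma prd_table:
  assumes "cayley_triple (\<odot>) (u, v, z)"
  shows "u \<odot> (u \<odot> v) = - v" "u \<odot> (u \<odot> z) = - z" "u \<odot> (v \<odot> z) = - ((u \<odot> v) \<odot> z)"
    "u \<odot> ((u \<odot> v) \<odot> z) = v \<odot> z"
    "v \<odot> (u \<odot> v) = u" "v \<odot> (u \<odot> z) = (u \<odot> v) \<odot> z" "v \<odot> (v \<odot> z) = - z"
    "v \<odot> ((u \<odot> v) \<odot> z) = - (u \<odot> z)"
    "(u \<odot> v) \<odot> (u \<odot> z) = - (v \<odot> z)" "(u \<odot> v) \<odot> (v \<odot> z) = u \<odot> z"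
    "(u \<odot> v) \<odot> ((u \<odot> v) \<odot> z) = - z"
    "z \<odot> (u \<odot> z) = u" "z \<odot> (v \<odot> z) = v" "z \<odot> ((u \<odot> v) \<odot> z) = u \<odot> v"
    "(u \<odot> z) \<odot> (v \<odot> z) = - (u \<odot> v)" "(u \<odot> z) \<odot> ((u \<odot> v) \<odot> z) = v"
    "(v \<odot> z) \<odot> ((u \<odot> v) \<odot> z) = - u"
proof -
  define a where "a = u \<odot> v"
  have o: "u \<bullet> u = 1" "v \<bullet> v = 1" "a \<bullet> a = 1" "z \<bullet> z = 1" "u \<bullet> v = 0" "u \<bullet> a = 0" "v \<bullet> a = 0"
    "u \<bullet> z = 0" "v \<bullet> z = 0" "a \<bullet> z = 0"
    using assms by (simp_all add: cayley_triple_def orthonormal_4 a_def)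
  have za: "z \<bullet> (u \<odot> v) = 0" "z \<bullet> u = 0" "z \<bullet> v = 0"
    using o by (simp_all add: inner_commute a_def)
  have same: "x \<odot> (x \<odot> y) = - y" "x \<odot> (y \<odot> x) = y" "(y \<odot> x) \<odot> x = - y"
    if "x \<bullet> x = 1" "x \<bullet> y = 0" for x y
    using that prd_prd_same[of x y]
    by (simp_all add: prd_anticommute[of x y] prd_anticommute[of "y \<odot> x" x] prd_linear)
  have swap: "x \<odot> (y \<odot> t) = - ((x \<odot> y) \<odot> t)" if "x \<bullet> y = 0" "x \<bullet> t = 0" "y \<bullet> t = 0" "(x \<odot> y) \<bullet> t = 0" for x y t
  proof -
    have "x \<odot> (y \<odot> t) = - (x \<odot> (t \<odot> y))"
      by (subst prd_anticommute) (simp add: prd_linear)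
    also have "\<dots> = t \<odot> (x \<odot> y)"
      using that by (simp add: prd_prd_swap[of x t y] inner_commute)
    finally show ?thesis by (simp add: prd_anticommute[of t])
  qed
  show "u \<odot> (u \<odot> v) = - v" "u \<odot> (u \<odot> z) = - z" "v \<odot> (u \<odot> v) = u" "v \<odot> (v \<odot> z) = - z"
    "(u \<odot> v) \<odot> ((u \<odot> v) \<odot> z) = - z"
    "z \<odot> (u \<odot> z) = u" "z \<odot> (v \<odot> z) = v" "z \<odot> ((u \<odot> v) \<odot> z) = u \<odot> v"
    using o za by (auto intro!: same simp: inner_commute a_def)
  show 1: "u \<odot> (v \<odot> z) = - ((u \<odot> v) \<odot> z)" 
    using o by (intro swap) (auto simp: a_def)
  show 2: "v \<odot> (u \<odot> z) = (u \<odot> v) \<odot> z" 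
    using o by (subst swap) (auto simp: a_def prd_anticommute[of v u] prd_linear inner_commute)
  show 3: "u \<odot> ((u \<odot> v) \<odot> z) = v \<odot> z"
    using o by (subst swap) (auto simp: a_def same prd_linear)
  show 4: "v \<odot> ((u \<odot> v) \<odot> z) = - (u \<odot> z)"
    using o by (subst swap) (auto simp: a_def same prd_linear inner_commute)
  have a: "a \<odot> u = v" "a \<odot> v = - u"
    using o same(1)[of u v] same(3)[of v u] prd_anticommute[of u a]
    by (simp_all add: prd_linear inner_commute minus_equation_iff[of _ u] flip: a_def)
  show 5: "(u \<odot> v) \<odot> (u \<odot> z) = - (v \<odot> z)" "(u \<odot> v) \<odot> (v \<odot> z) = u \<odot> z"
    using o a by (simp_all add: swap prd_linear inner_commute flip: a_def)
  have z: "(u \<odot> z) \<odot> z = - u" "(v \<odot> z) \<odot> z = - v" "(a \<odot> z) \<odot> z = - a"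
    using o by (simp_all add: same inner_commute)
  have i1: "(u \<odot> z) \<bullet> v = 0"
    using o by (simp add: inner_prd_swap[of u z v] flip: a_def)
  have i2: "(u \<odot> z) \<bullet> z = 0" "(v \<odot> z) \<bullet> z = 0" by (simp_all add: inner_prd_right)
  have i3: "(u \<odot> z) \<bullet> a = 0"
    using o inner_prd_prd_left[of u z v] by (simp add: inner_commute flip: a_def)
  have i4: "(v \<odot> z) \<bullet> a = 0"
    using o inner_prd_prd_left[of v z u] by (simp add: prd_anticommute[of v u] inner_commute flip: a_def)
  note i = i1 i2 i3 i4
  have "(u \<odot> z) \<odot> (v \<odot> z) = - a"
    using o i z a by (simp add: prd_prd_swap[of "u \<odot> z"] prd_linear prd_anticommute[of v u] flip: a_def)
  then show "(u \<odot> z) \<odot> (v \<odot> z) = - (u \<odot> v)" by (simp add: a_def)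
  have "(u \<odot> z) \<odot> (a \<odot> z) = v"
    using o i z a by (simp add: prd_prd_swap[of "u \<odot> z"] prd_linear)
  then show "(u \<odot> z) \<odot> ((u \<odot> v) \<odot> z) = v" by (simp add: a_def)
  have "(v \<odot> z) \<odot> (a \<odot> z) = - u"
    using o i z a by (simp add: prd_prd_swap[of "v \<odot> z"] prd_linear)
  then show "(v \<odot> z) \<odot> ((u \<odot> v) \<odot> z) = - u" by (simp add: a_def)
qed

end

section \<open>Orthonormal frames and matrices\<close>

definition orthonormal_frame :: "'a::euclidean_space ^ 'n \<Rightarrow> bool" where
  "orthonormal_frame f \<longleftrightarrow> (\<forall>i j. f $ i \<bullet> f $ j = (if i = j then 1 else 0))"

lemma orthonormal_frame_inj: "orthonormal_frame f \<Longrightarrow> inj (($) f)"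
  by (rule injI) (metis orthonormal_frame_def zero_neq_one)

lemma orthonormal_frame_spans:
  fixes f :: "'a::euclidean_space ^ 'n"
  assumes f: "orthonormal_frame f" and card: "CARD('n) = DIM('a)"
  shows "independent (range (($) f))" "span (range (($) f)) = UNIV"
proof -
  show ind: "independent (range (($) f))"
  proof (rule pairwise_orthogonal_independent)
    show "pairwise orthogonal (range (($) f))"
      using f by (auto simp: pairwise_def orthogonal_def orthonormal_frame_def split: if_splits)
    show "0 \<notin> range (($) f)"
      using f by (metis orthonormal_frame_def imageE inner_zero_left zero_neq_one)
  qed
  have "card (range (($) f)) = DIM('a)"
    using card orthonormal_frame_inj[OF f] by (simp add: card_image)
  then show "span (range (($) f)) = UNIV"
    using ind by (metis card_ge_dim_independent subset_UNIV dim_UNIV order_refl top.extremum_uniqueI)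
qed

lemma orthonormal_frame_eqI:
  fixes f :: "'a::euclidean_space ^ 'n"
  assumes "orthonormal_frame f" "CARD('n) = DIM('a)" and eq: "\<And>i. x \<bullet> f $ i = y \<bullet> f $ i"
  shows "x = y"
proof -
  have "orthogonal (x - y) b" if "b \<in> range (($) f)" for b
    using that eq by (auto simp: orthogonal_def inner_diff_left)
  then have "orthogonal (x - y) (x - y)"
    using orthonormal_frame_spans(2)[OF assms(1,2)]
    by (metis UNIV_I orthogonal_to_span)
  then show ?thesis by (simp add: orthogonal_self)
qed

lemma inner_frame_sum:
  assumes "orthonormal_frame f"
  shows "(\<Sum>i\<in>UNIV. c i *\<^sub>R f $ i) \<bullet> f $ j = c j"
proof -
  have "(\<Sum>i\<in>UNIV. c i *\<^sub>R f $ i) \<bullet> f $ j = (\<Sum>i\<in>UNIV. if i = j then c i else 0)"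
    unfolding inner_sum_left using assms by (intro sum.cong) (auto simp: orthonormal_frame_def)
  then show ?thesis by simp
qed

lemma orthonormal_frame_expand:
  fixes f :: "'a::euclidean_space ^ 'n"
  assumes "orthonormal_frame f" "CARD('n) = DIM('a)"
  shows "(\<Sum>i\<in>UNIV. (x \<bullet> f $ i) *\<^sub>R f $ i) = x"
  by (rule orthonormal_frame_eqI[OF assms]) (rule inner_frame_sum[OF assms(1)])

definition frame_coords :: "'a::euclidean_space ^ 'n \<Rightarrow> 'a \<Rightarrow> real ^ 'n" where
  "frame_coords f x = (\<chi> i. x \<bullet> f $ i)"

lemma linear_frame_coords: "linear (frame_coords f)"
  by (rule linearI) (simp_all add: frame_coords_def vec_eq_iff inner_add_left)

lemma frame_coords_sum:
  "orthonormal_frame f \<Longrightarrow> frame_coords f (\<Sum>i\<in>UNIV. (y $ i) *\<^sub>R f $ i) = y"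
  by (simp add: frame_coords_def vec_eq_iff inner_frame_sum)

lemma inner_frame_coords:
  fixes f :: "'a::euclidean_space ^ 'n"
  assumes "orthonormal_frame f" "CARD('n) = DIM('a)"
  shows "frame_coords f x \<bullet> frame_coords f y = x \<bullet> y"
proof -
  have "frame_coords f x \<bullet> frame_coords f y = (\<Sum>i\<in>UNIV. (x \<bullet> f $ i) *\<^sub>R f $ i) \<bullet> y"
    unfolding frame_coords_def inner_vec_def
    by (simp add: inner_sum_left) (simp add: inner_commute)
  then show ?thesis by (simp add: orthonormal_frame_expand[OF assms])
qed

lemma inj_frame_coords:
  fixes f :: "'a::euclidean_space ^ 'n"
  assumes "orthonormal_frame f" "CARD('n) = DIM('a)"
  shows "inj (frame_coords f)"
proof (rule injI)
  fix x y assume "frame_coords f x = frame_coords f y"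
  then have "x \<bullet> f $ i = y \<bullet> f $ i" for i by (simp add: frame_coords_def vec_eq_iff)
  then show "x = y" by (intro orthonormal_frame_eqI[OF assms])
qed

lemma representation_orthonormal_frame:
  fixes f :: "'a::euclidean_space ^ 'n"
  assumes "orthonormal_frame f" "CARD('n) = DIM('a)"
  shows "representation (range (($) f)) x (f $ i) = x \<bullet> f $ i"
proof -
  let ?r = "representation (range (($) f)) x"
  note sp = orthonormal_frame_spans[OF assms]
  have "x = (\<Sum>b\<in>range (($) f). ?r b *\<^sub>R b)"
    using sp by (intro sum_representation_eq[symmetric]) auto
  also have "\<dots> = (\<Sum>j\<in>UNIV. ?r (f $ j) *\<^sub>R f $ j)"
    by (simp add: sum.reindex[OF orthonormal_frame_inj[OF assms(1)]])
  finally show ?thesis using inner_frame_sum[OF assms(1)] by metis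
qed

lemma matrix_in_basis_nth:
  fixes f :: "'a::euclidean_space ^ 7"
  assumes "orthonormal_frame f" "DIM('a) = 7"
  shows "matrix_in_basis f \<delta> $ i $ j = \<delta> (f $ j) \<bullet> f $ i"
  using assms by (simp add: matrix_in_basis_def representation_orthonormal_frame)

lemma ex_sym_endo_of_matrix:
  fixes f :: "'a::euclidean_space ^ 7"
  assumes f: "orthonormal_frame f" "DIM('a) = 7" and M: "transpose M = M"
  shows "\<exists>\<delta>\<in>sym_endo. matrix_in_basis f \<delta> = M"
proof -
  define \<delta> where "\<delta> x = (\<Sum>i\<in>UNIV. ((M *v frame_coords f x) $ i) *\<^sub>R f $ i)" for x
  have "linear \<delta>"
  proof (rule linearI)
    show "\<delta> (x + y) = \<delta> x + \<delta> y" for x y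
      by (simp add: \<delta>_def linear_add[OF linear_frame_coords] matrix_vector_right_distrib
          scaleR_add_left sum.distrib)
    show "\<delta> (c *\<^sub>R x) = c *\<^sub>R \<delta> x" for c x
      by (simp add: \<delta>_def linear_scale[OF linear_frame_coords] matrix_vector_mult_scaleR
          scaleR_sum_right)
  qed
  moreover have "\<delta> x \<bullet> y = x \<bullet> \<delta> y" for x y
  proof -
    have coords: "frame_coords f (\<delta> x) = M *v frame_coords f x" for x
      unfolding \<delta>_def by (rule frame_coords_sum[OF f(1)])
    have "(M *v v) \<bullet> w = v \<bullet> (M *v w)" for v w
      using M by (metis dot_lmul_matrix transpose_matrix_vector)
    then have "frame_coords f (\<delta> x) \<bullet> frame_coords f y = frame_coords f x \<bullet> frame_coords f (\<delta> y)"
      by (simp add: coords)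
    then show ?thesis using f by (simp add: inner_frame_coords)
  qed
  moreover have "matrix_in_basis f \<delta> = M"
  proof -
    have axis: "frame_coords f (f $ j) = axis j 1" for j
      using f(1) by (auto simp: frame_coords_def vec_eq_iff axis_def orthonormal_frame_def)
    have "matrix_in_basis f \<delta> $ i $ j = M $ i $ j" for i j
      unfolding matrix_in_basis_nth[OF f] \<delta>_def inner_frame_sum[OF f(1)] axis
      by (simp add: matrix_vector_mult_basis column_def)
    then show ?thesis by (simp add: vec_eq_iff)
  qed
  ultimately show ?thesis by (auto simp: sym_endo_def)
qed

lemma matrix_in_basis_inj:
  fixes f :: "'a::euclidean_space ^ 7"
  assumes f: "orthonormal_frame f" "DIM('a) = 7"
    and lin: "linear \<delta>" "linear \<delta>'" and eq: "matrix_in_basis f \<delta> = matrix_in_basis f \<delta>'"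
  shows "\<delta> = \<delta>'"
proof
  fix x
  have "\<delta> (f $ j) = \<delta>' (f $ j)" for j
    using f eq by (intro orthonormal_frame_eqI[OF f(1)]) (simp_all flip: matrix_in_basis_nth)
  then have "\<delta> (\<Sum>i\<in>UNIV. (x \<bullet> f $ i) *\<^sub>R f $ i) = \<delta>' (\<Sum>i\<in>UNIV. (x \<bullet> f $ i) *\<^sub>R f $ i)"
    using lin by (simp add: linear_sum linear_scale)
  then show "\<delta> x = \<delta>' x" using f by (simp add: orthonormal_frame_expand)
qed

text \<open>
  Coordinates in an orthonormal frame identify eigenvectors of an endomorphism with those of its
  matrix, so the multiplicities of the matrix can be read off from the endomorphism.
\<close>

lemma matrix_in_basis_eigenspace:
  fixes f :: "'a::euclidean_space ^ 7"
  assumes f: "orthonormal_frame f" "DIM('a) = 7" and lin: "linear \<delta>"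
  defines "M \<equiv> matrix_in_basis f \<delta>"
  shows "dim (eigenspace M l) = dim {x. \<delta> x = l *\<^sub>R x}"
    and "eigenvalue M l \<longleftrightarrow> (\<exists>x. x \<noteq> 0 \<and> \<delta> x = l *\<^sub>R x)"
proof -
  define T where "T = frame_coords f"
  have linT: "linear T" unfolding T_def by (rule linear_frame_coords)
  have inj: "inj T" unfolding T_def using f by (intro inj_frame_coords) auto
  have surj: "\<exists>x. y = T x" for y unfolding T_def using frame_coords_sum[OF f(1)] by metis
  have MT: "M *v T x = T (\<delta> x)" for x
  proof -
    have "\<delta> x = \<delta> (\<Sum>i\<in>UNIV. (x \<bullet> f $ i) *\<^sub>R f $ i)"
      using f by (simp add: orthonormal_frame_expand)
    then have "\<delta> x \<bullet> f $ i = (\<Sum>j\<in>UNIV. (\<delta> (f $ j) \<bullet> f $ i) * (x \<bullet> f $ j))" for i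
      using lin by (simp add: linear_sum linear_scale inner_sum_left mult.commute)
    then show ?thesis
      by (simp add: vec_eq_iff matrix_vector_mult_def T_def frame_coords_def M_def
          matrix_in_basis_nth[OF f])
  qed
  have "T (\<delta> x) = l *\<^sub>R T x \<longleftrightarrow> \<delta> x = l *\<^sub>R x" for x
    using inj linT by (metis injD linear_scale)
  then have iff: "M *v T x = l *\<^sub>R T x \<longleftrightarrow> \<delta> x = l *\<^sub>R x" for x by (simp add: MT)
  have "eigenspace M l = T ` {x. \<delta> x = l *\<^sub>R x}"
  proof safe
    fix y assume "y \<in> eigenspace M l"
    then show "y \<in> T ` {x. \<delta> x = l *\<^sub>R x}"
      using iff surj[of y] unfolding eigenspace_def by (metis (mono_tags, lifting) image_eqI mem_Collect_eq)
  qed (simp add: eigenspace_def iff)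
  then show "dim (eigenspace M l) = dim {x. \<delta> x = l *\<^sub>R x}"
    using dim_image_eq[OF linT] inj inj_on_subset by (metis top_greatest)
  have "T x = 0 \<longleftrightarrow> x = 0" for x
    using inj linT by (metis injD linear_0)
  then show "eigenvalue M l \<longleftrightarrow> (\<exists>x. x \<noteq> 0 \<and> \<delta> x = l *\<^sub>R x)"
    unfolding eigenvalue_def using iff surj by metis
qed

text \<open>
  In a frame of eigenvectors, the coordinates of an eigenvector for \<open>l\<close> vanish outside the frame
  vectors that belong to \<open>l\<close>; these therefore form a basis of the eigenspace.
\<close>

lemma frame_eigenspace:
  fixes f :: "'a::euclidean_space ^ 'n"
  assumes f: "orthonormal_frame f" "CARD('n) = DIM('a)" and lin: "linear \<delta>"
    and ev: "\<And>i. \<delta> (f $ i) = e i *\<^sub>R f $ i"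
  shows "\<delta> x = l *\<^sub>R x \<longleftrightarrow> (\<forall>i. e i \<noteq> l \<longrightarrow> x \<bullet> f $ i = 0)"
    and "dim {x. \<delta> x = l *\<^sub>R x} = card {i. e i = l}"
proof -
  have "\<delta> x = (\<Sum>i\<in>UNIV. (x \<bullet> f $ i * e i) *\<^sub>R f $ i)" for x
  proof -
    have "\<delta> x = \<delta> (\<Sum>i\<in>UNIV. (x \<bullet> f $ i) *\<^sub>R f $ i)"
      using f by (simp add: orthonormal_frame_expand)
    then show ?thesis using lin by (simp add: linear_sum linear_scale ev)
  qed
  then have i: "\<delta> x \<bullet> f $ j = (x \<bullet> f $ j) * e j" for x j
    using f(1) by (simp add: inner_frame_sum)
  have "\<delta> x = l *\<^sub>R x \<longleftrightarrow> (\<forall>j. \<delta> x \<bullet> f $ j = (l *\<^sub>R x) \<bullet> f $ j)" for x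
    using orthonormal_frame_eqI[OF f] by metis
  then show *: "\<delta> x = l *\<^sub>R x \<longleftrightarrow> (\<forall>i. e i \<noteq> l \<longrightarrow> x \<bullet> f $ i = 0)" for x
    by (auto simp: i)
  have "{x. \<delta> x = l *\<^sub>R x} = span (($) f ` {i. e i = l})"
  proof
    show "span (($) f ` {i. e i = l}) \<subseteq> {x. \<delta> x = l *\<^sub>R x}"
      using lin by (intro span_minimal)
        (auto simp: ev subspace_def linear_0 linear_add linear_scale algebra_simps)
    show "{x. \<delta> x = l *\<^sub>R x} \<subseteq> span (($) f ` {i. e i = l})"
    proof safe
      fix x assume "\<delta> x = l *\<^sub>R x"
      then have "(x \<bullet> f $ i) *\<^sub>R f $ i \<in> span (($) f ` {i. e i = l})" for i
        using * by (cases "e i = l") (auto intro: span_base span_scale simp: span_zero)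
      then have "(\<Sum>i\<in>UNIV. (x \<bullet> f $ i) *\<^sub>R f $ i) \<in> span (($) f ` {i. e i = l})"
        by (intro span_sum)
      then show "x \<in> span (($) f ` {i. e i = l})"
        using f by (simp add: orthonormal_frame_expand)
    qed
  qed
  moreover have "independent (($) f ` {i. e i = l})"
    using orthonormal_frame_spans(1)[OF f] by (rule independent_mono) auto
  ultimately show "dim {x. \<delta> x = l *\<^sub>R x} = card {i. e i = l}"
    using orthonormal_frame_inj[OF f(1)]
    by (simp add: dim_span dim_eq_card_independent card_image inj_on_subset)
qed

section \<open>Cayley bases and orbits\<close>

lemma cayley_basis_nth:
  "cayley_basis prd (u, v, z) $ 1 = u"
  "cayley_basis prd (u, v, z) $ 2 = v"
  "cayley_basis prd (u, v, z) $ 3 = prd u v"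
  "cayley_basis prd (u, v, z) $ 4 = z"
  "cayley_basis prd (u, v, z) $ 5 = prd u z"
  "cayley_basis prd (u, v, z) $ 6 = prd v z"
  "cayley_basis prd (u, v, z) $ 7 = prd (prd u v) z"
  by (simp_all add: cayley_basis_def vector_7)

lemma orthonormal_frame_7:
  fixes f :: "'a::euclidean_space ^ 7"
  shows "orthonormal_frame f \<longleftrightarrow>
    f$1 \<bullet> f$1 = 1 \<and> f$2 \<bullet> f$2 = 1 \<and> f$3 \<bullet> f$3 = 1 \<and> f$4 \<bullet> f$4 = 1 \<and> f$5 \<bullet> f$5 = 1 \<and> f$6 \<bullet> f$6 = 1 \<and> f$7 \<bullet> f$7 = 1 \<and>
    f$1 \<bullet> f$2 = 0 \<and> f$1 \<bullet> f$3 = 0 \<and> f$1 \<bullet> f$4 = 0 \<and> f$1 \<bullet> f$5 = 0 \<and> f$1 \<bullet> f$6 = 0 \<and> f$1 \<bullet> f$7 = 0 \<and>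
    f$2 \<bullet> f$3 = 0 \<and> f$2 \<bullet> f$4 = 0 \<and> f$2 \<bullet> f$5 = 0 \<and> f$2 \<bullet> f$6 = 0 \<and> f$2 \<bullet> f$7 = 0 \<and>
    f$3 \<bullet> f$4 = 0 \<and> f$3 \<bullet> f$5 = 0 \<and> f$3 \<bullet> f$6 = 0 \<and> f$3 \<bullet> f$7 = 0 \<and>
    f$4 \<bullet> f$5 = 0 \<and> f$4 \<bullet> f$6 = 0 \<and> f$4 \<bullet> f$7 = 0 \<and>
    f$5 \<bullet> f$6 = 0 \<and> f$5 \<bullet> f$7 = 0 \<and> f$6 \<bullet> f$7 = 0"
  unfolding orthonormal_frame_def forall_7 by (simp add: inner_commute) blast

context vector_product_space
begin

lemma orthonormal_frame_cayley_basis: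
  assumes "cayley_triple (\<odot>) s"
  shows "orthonormal_frame (cayley_basis (\<odot>) s)"
proof -
  obtain u v z where s: "s = (u, v, z)" by (cases s)
  define a where "a = u \<odot> v"
  have o: "u \<bullet> u = 1" "v \<bullet> v = 1" "a \<bullet> a = 1" "z \<bullet> z = 1" "u \<bullet> v = 0" "u \<bullet> a = 0" "v \<bullet> a = 0"
    "u \<bullet> z = 0" "v \<bullet> z = 0" "a \<bullet> z = 0"
    using assms by (simp_all add: cayley_triple_def orthonormal_4 a_def s)
  have za: "z \<bullet> u = 0" "z \<bullet> v = 0" "z \<bullet> a = 0"
    using o by (simp_all add: inner_commute)
  have right: "(y \<odot> z) \<bullet> (w \<odot> z) = (z \<bullet> z) * (y \<bullet> w) - (z \<bullet> y) * (z \<bullet> w)" for y w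
    using inner_prd_prd_left[of z y w] by (simp add: prd_anticommute[of z])
  have left: "x \<bullet> (x \<odot> y) = 0" "x \<bullet> (y \<odot> x) = 0" for x y
    using inner_prd_left[of x y] inner_prd_right[of y x] by (simp_all add: inner_commute)
  have au: "a \<odot> u = v" "a \<odot> v = - u"
    using prd_table(1,5)[OF assms[unfolded s]] prd_anticommute[of a u] prd_anticommute[of a v]
    by (simp_all add: a_def)
  have mixed: "u \<bullet> (v \<odot> z) = 0" "v \<bullet> (u \<odot> z) = 0" "u \<bullet> (a \<odot> z) = 0" "v \<bullet> (a \<odot> z) = 0"
    "a \<bullet> (u \<odot> z) = 0" "a \<bullet> (v \<odot> z) = 0"
    using o inner_prd_swap[of v z u] inner_prd_swap[of u z v] inner_prd_swap[of a z u]
      inner_prd_swap[of a z v] inner_prd_swap[of u z a] inner_prd_swap[of v z a]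
      prd_anticommute[of v u] prd_anticommute[of u a] prd_anticommute[of v a] au
    by (simp_all add: inner_commute[of _ "_ \<odot> z"] flip: a_def)
  show ?thesis
    unfolding s orthonormal_frame_7 cayley_basis_nth a_def[symmetric]
    using o mixed za by (simp add: left right)
qed

end

locale vector_product_space_7 = vector_product_space prd
  for prd :: "'a::euclidean_space \<Rightarrow> 'a \<Rightarrow> 'a"  (infixl \<open>\<odot>\<close> 75) +
  assumes dim_7: "DIM('a) = 7"
begin

lemma card_index: "CARD(7) = DIM('a)"
  by (simp add: dim_7)

text \<open>
  The isometry that carries one Cayley basis to another respects the product because it does so on
  basis vectors, where both sides are given by the same table.
\<close>

lemma G2_transitive:
  assumes s: "cayley_triple (\<odot>) s" and t: "cayley_triple (\<odot>) t"
  obtains g where "g \<in> G2 (\<odot>)" "\<And>i. g (cayley_basis (\<odot>) s $ i) = cayley_basis (\<odot>) t $ i"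
proof -
  define b where "b = cayley_basis (\<odot>) s"
  define c where "c = cayley_basis (\<odot>) t"
  have b: "orthonormal_frame b" and c: "orthonormal_frame c"
    using s t by (simp_all add: b_def c_def orthonormal_frame_cayley_basis)
  define g where "g x = (\<Sum>i\<in>UNIV. (x \<bullet> b $ i) *\<^sub>R c $ i)" for x
  have lin: "linear g"
    by (rule linearI) (simp_all add: g_def inner_add_left scaleR_add_left sum.distrib scaleR_sum_right)
  have gb: "g (b $ i) = c $ i" for i
  proof -
    have "g (b $ i) = (\<Sum>j\<in>UNIV. if i = j then c $ j else 0)"
      unfolding g_def using b by (intro sum.cong) (auto simp: orthonormal_frame_def)
    then show ?thesis by simp
  qed
  have "g x \<bullet> g y = x \<bullet> y" for x y
  proof -
    have "g x \<bullet> c $ i = x \<bullet> b $ i" for x i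
      unfolding g_def by (rule inner_frame_sum[OF c])
    then have "frame_coords c (g x) = frame_coords b x" for x
      by (simp add: frame_coords_def)
    then show ?thesis
      using inner_frame_coords[OF b card_index] inner_frame_coords[OF c card_index] by metis
  qed
  then have orth: "orthogonal_transformation g"
    using lin by (simp add: orthogonal_transformation_def)
  have table: "g (b $ i \<odot> b $ j) = c $ i \<odot> c $ j" for i j
  proof -
    obtain u v z where s': "s = (u, v, z)" by (cases s)
    obtain u' v' z' where t': "t = (u', v', z')" by (cases t)
    note gb' = gb[unfolded b_def c_def s' t']
    have gb7: "g u = u'" "g v = v'" "g (u \<odot> v) = u' \<odot> v'" "g z = z'"
      "g (u \<odot> z) = u' \<odot> z'" "g (v \<odot> z) = v' \<odot> z'" "g ((u \<odot> v) \<odot> z) = (u' \<odot> v') \<odot> z'"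
      using gb'[of 1] gb'[of 2] gb'[of 3] gb'[of 4] gb'[of 5] gb'[of 6] gb'[of 7]
      by (simp_all add: cayley_basis_nth)
    \<comment> \<open>The 21 products with increasing indices; the remaining ones follow by anticommutativity.\<close>
    have lt:
      "g (b$1 \<odot> b$2) = c$1 \<odot> c$2" "g (b$1 \<odot> b$3) = c$1 \<odot> c$3" "g (b$1 \<odot> b$4) = c$1 \<odot> c$4"
      "g (b$1 \<odot> b$5) = c$1 \<odot> c$5" "g (b$1 \<odot> b$6) = c$1 \<odot> c$6" "g (b$1 \<odot> b$7) = c$1 \<odot> c$7"
      "g (b$2 \<odot> b$3) = c$2 \<odot> c$3" "g (b$2 \<odot> b$4) = c$2 \<odot> c$4" "g (b$2 \<odot> b$5) = c$2 \<odot> c$5"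
      "g (b$2 \<odot> b$6) = c$2 \<odot> c$6" "g (b$2 \<odot> b$7) = c$2 \<odot> c$7" "g (b$3 \<odot> b$4) = c$3 \<odot> c$4"
      "g (b$3 \<odot> b$5) = c$3 \<odot> c$5" "g (b$3 \<odot> b$6) = c$3 \<odot> c$6" "g (b$3 \<odot> b$7) = c$3 \<odot> c$7"
      "g (b$4 \<odot> b$5) = c$4 \<odot> c$5" "g (b$4 \<odot> b$6) = c$4 \<odot> c$6" "g (b$4 \<odot> b$7) = c$4 \<odot> c$7"
      "g (b$5 \<odot> b$6) = c$5 \<odot> c$6" "g (b$5 \<odot> b$7) = c$5 \<odot> c$7" "g (b$6 \<odot> b$7) = c$6 \<odot> c$7"
      unfolding b_def c_def s' t' cayley_basis_nth
      by (simp_all add: prd_table[OF s[unfolded s']] prd_table[OF t[unfolded t']]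
          gb7 linear_neg[OF lin])
    have gt: "g (b $ i \<odot> b $ j) = c $ i \<odot> c $ j" if "g (b $ j \<odot> b $ i) = c $ j \<odot> c $ i" for i j
      using that prd_anticommute[of "b $ i" "b $ j"] prd_anticommute[of "c $ i" "c $ j"]
      by (simp add: linear_neg[OF lin])
    have "\<forall>i j. g (b $ i \<odot> b $ j) = c $ i \<odot> c $ j"
      unfolding forall_7
      by (intro conjI) (simp_all add: linear_0[OF lin] lt lt[THEN gt])
    then show ?thesis by blast
  qed
  have "g (x \<odot> y) = g x \<odot> g y" for x y
  proof -
    have bl1: "bilinear (\<lambda>x y. g (x \<odot> y))" and bl2: "bilinear (\<lambda>x y. g x \<odot> g y)"
      by (simp_all add: bilinear_def linear_iff prd_linear linear_add[OF lin] linear_scale[OF lin])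
    show ?thesis
    proof (rule bilinear_eq[OF bl1 bl2, of UNIV "range (($) b)" UNIV "range (($) b)"])
      fix x y assume "x \<in> range (($) b)" "y \<in> range (($) b)"
      then show "g (x \<odot> y) = g x \<odot> g y" by (auto simp: table gb)
    qed (simp_all add: orthonormal_frame_spans(2)[OF b card_index])
  qed
  then have "g \<in> G2 (\<odot>)" using orth by (simp add: G2_def)
  with gb show thesis using that unfolding b_def c_def by blast
qed

lemma G2_cayley:
  assumes g: "g \<in> G2 (\<odot>)" and s: "cayley_triple (\<odot>) (u, v, z)"
  shows "cayley_triple (\<odot>) (g u, g v, g z)"
    and "cayley_basis (\<odot>) (g u, g v, g z) $ i = g (cayley_basis (\<odot>) (u, v, z) $ i)"
proof -
  have gp: "g x \<odot> g y = g (x \<odot> y)" and gi: "g x \<bullet> g y = x \<bullet> y" for x y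
    using g by (simp_all add: G2_def orthogonal_transformation_def)
  show "cayley_triple (\<odot>) (g u, g v, g z)"
    using s by (simp add: cayley_triple_def orthonormal_4 gp gi)
  have "\<forall>i. cayley_basis (\<odot>) (g u, g v, g z) $ i = g (cayley_basis (\<odot>) (u, v, z) $ i)"
    unfolding forall_7 by (simp add: cayley_basis_nth gp)
  then show "cayley_basis (\<odot>) (g u, g v, g z) $ i = g (cayley_basis (\<odot>) (u, v, z) $ i)" by blast
qed

lemma matrix_in_basis_conj:
  fixes g \<delta> :: "'a \<Rightarrow> 'a" and b c :: "'a ^ 7"
  assumes g: "orthogonal_transformation g"
    and b: "orthonormal_frame b" and c: "orthonormal_frame c" and bc: "\<And>i. g (b $ i) = c $ i"
  shows "matrix_in_basis b (inv g \<circ> \<delta> \<circ> g) = matrix_in_basis c \<delta>"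
proof -
  have "inv g x \<bullet> y = x \<bullet> g y" for x y
  proof -
    have "g (inv g x) = x"
      by (rule surj_f_inv_f[OF orthogonal_transformation_surj[OF g]])
    then have "x \<bullet> g y = g (inv g x) \<bullet> g y" by simp
    also have "\<dots> = inv g x \<bullet> y"
      using g unfolding orthogonal_transformation_def by blast
    finally show ?thesis by simp
  qed
  then show ?thesis
    by (simp add: vec_eq_iff matrix_in_basis_nth[OF b dim_7] matrix_in_basis_nth[OF c dim_7] bc)
qed

text \<open>
  Conjugating \<open>\<delta>\<close> by \<open>g\<close> has the same effect on the matrix as moving the Cayley basis by \<open>g\<close>, and by
  transitivity every Cayley basis arises in this way.  Orbits thereby become families of matrices of
  a single endomorphism.
\<close>

lemma G2_orbit_eq:
  assumes s: "cayley_triple (\<odot>) s" and \<delta>: "\<delta> \<in> sym_endo"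
  shows "G2_orbit (\<odot>) s (matrix_in_basis (cayley_basis (\<odot>) s) \<delta>) =
    {matrix_in_basis (cayley_basis (\<odot>) t) \<delta> | t. cayley_triple (\<odot>) t}"
proof -
  note frame = orthonormal_frame_cayley_basis
  have uniq: "\<delta>' = \<delta>" if "\<delta>' \<in> sym_endo"
    "matrix_in_basis (cayley_basis (\<odot>) s) \<delta>' = matrix_in_basis (cayley_basis (\<odot>) s) \<delta>" for \<delta>'
    using matrix_in_basis_inj[OF frame[OF s] dim_7 _ _ that(2)] that(1) \<delta> by (simp add: sym_endo_def)
  have to_triple: "\<exists>t. cayley_triple (\<odot>) t \<and> matrix_in_basis (cayley_basis (\<odot>) s) (inv g \<circ> \<delta> \<circ> g) =
      matrix_in_basis (cayley_basis (\<odot>) t) \<delta>" if "g \<in> G2 (\<odot>)" for g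
  proof -
    obtain u v z where s': "s = (u, v, z)" by (cases s)
    note gs = G2_cayley[OF that s[unfolded s']]
    have "orthogonal_transformation g" using that by (simp add: G2_def)
    then have "matrix_in_basis (cayley_basis (\<odot>) s) (inv g \<circ> \<delta> \<circ> g) =
        matrix_in_basis (cayley_basis (\<odot>) (g u, g v, g z)) \<delta>"
      by (rule matrix_in_basis_conj[OF _ frame[OF s] frame[OF gs(1)]]) (simp add: gs(2) s')
    with gs(1) show ?thesis by blast
  qed
  have of_triple: "\<exists>g\<in>G2 (\<odot>). matrix_in_basis (cayley_basis (\<odot>) t) \<delta> =
      matrix_in_basis (cayley_basis (\<odot>) s) (inv g \<circ> \<delta> \<circ> g)" if t: "cayley_triple (\<odot>) t" for t
  proof -
    obtain g where g: "g \<in> G2 (\<odot>)" "\<And>i. g (cayley_basis (\<odot>) s $ i) = cayley_basis (\<odot>) t $ i"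
      by (rule G2_transitive[OF s t]) blast
    then have "orthogonal_transformation g" by (simp add: G2_def)
    then have "matrix_in_basis (cayley_basis (\<odot>) s) (inv g \<circ> \<delta> \<circ> g) =
        matrix_in_basis (cayley_basis (\<odot>) t) \<delta>"
      by (rule matrix_in_basis_conj[OF _ frame[OF s] frame[OF t]]) (rule g(2))
    with g(1) show ?thesis by metis
  qed
  show ?thesis (is "?O = ?R")
  proof (intro equalityI subsetI)
    fix N assume "N \<in> ?O"
    then obtain \<delta>' g where "\<delta>' \<in> sym_endo" "g \<in> G2 (\<odot>)"
      "matrix_in_basis (cayley_basis (\<odot>) s) \<delta>' = matrix_in_basis (cayley_basis (\<odot>) s) \<delta>"
      "N = matrix_in_basis (cayley_basis (\<odot>) s) (inv g \<circ> \<delta>' \<circ> g)"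
      unfolding G2_orbit_def by blast
    moreover from this have "\<delta>' = \<delta>" by (intro uniq)
    ultimately have "N = matrix_in_basis (cayley_basis (\<odot>) s) (inv g \<circ> \<delta> \<circ> g)" by simp
    with to_triple[OF \<open>g \<in> G2 (\<odot>)\<close>] show "N \<in> ?R" by auto
  next
    fix N assume "N \<in> ?R"
    then obtain t where "cayley_triple (\<odot>) t" "N = matrix_in_basis (cayley_basis (\<odot>) t) \<delta>" by blast
    with of_triple[of t] \<delta> show "N \<in> ?O" unfolding G2_orbit_def by auto
  qed
qed

end

section \<open>The normal form as a condition on eigenvectors\<close>

text \<open>
  The vectors 3, 4 and 6, 7 are turned by the rotations that diagonalise the two blocks of size 2, so
  vector 3 belongs to the eigenvalue \<open>\<nu>\<close>, vectors 4 and 6 to \<open>lam\<close>, and vector 7 to \<open>\<mu>\<close>.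
\<close>

definition rotated_frame :: "'a::euclidean_space ^ 7 \<Rightarrow> real \<Rightarrow> real \<Rightarrow> 'a ^ 7" where
  "rotated_frame b \<alpha> \<theta> = vector
    [b$1, b$2, cos \<alpha> *\<^sub>R b$3 - sin \<alpha> *\<^sub>R b$4, sin \<alpha> *\<^sub>R b$3 + cos \<alpha> *\<^sub>R b$4,
     b$5, cos \<theta> *\<^sub>R b$6 - sin \<theta> *\<^sub>R b$7, sin \<theta> *\<^sub>R b$6 + cos \<theta> *\<^sub>R b$7]"

definition normal_form :: "real \<Rightarrow> real \<Rightarrow> real \<Rightarrow> real \<Rightarrow> real \<Rightarrow> real ^ 7 ^ 7" where
  "normal_form lam \<mu> \<nu> \<alpha> \<theta> = block_diag (\<nu> *\<^sub>R mat 1)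
     (matrix_inv (rot \<alpha>) ** diag2 \<nu> lam ** rot \<alpha>) \<mu>
     (matrix_inv (rot \<theta>) ** diag2 lam \<mu> ** rot \<theta>)"

definition frame_eigenvalues :: "real \<Rightarrow> real \<Rightarrow> real \<Rightarrow> real ^ 7" where
  "frame_eigenvalues lam \<mu> \<nu> = vector [\<nu>, \<nu>, \<nu>, lam, \<mu>, lam, \<mu>]"

lemma rotated_frame_nth:
  "rotated_frame b \<alpha> \<theta> $ 1 = b$1" "rotated_frame b \<alpha> \<theta> $ 2 = b$2"
  "rotated_frame b \<alpha> \<theta> $ 3 = cos \<alpha> *\<^sub>R b$3 - sin \<alpha> *\<^sub>R b$4"
  "rotated_frame b \<alpha> \<theta> $ 4 = sin \<alpha> *\<^sub>R b$3 + cos \<alpha> *\<^sub>R b$4"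
  "rotated_frame b \<alpha> \<theta> $ 5 = b$5"
  "rotated_frame b \<alpha> \<theta> $ 6 = cos \<theta> *\<^sub>R b$6 - sin \<theta> *\<^sub>R b$7"
  "rotated_frame b \<alpha> \<theta> $ 7 = sin \<theta> *\<^sub>R b$6 + cos \<theta> *\<^sub>R b$7"
  by (simp_all add: rotated_frame_def vector_7)

lemma frame_eigenvalues_nth:
  "frame_eigenvalues lam \<mu> \<nu> $ 1 = \<nu>" "frame_eigenvalues lam \<mu> \<nu> $ 2 = \<nu>" "frame_eigenvalues lam \<mu> \<nu> $ 3 = \<nu>"
  "frame_eigenvalues lam \<mu> \<nu> $ 4 = lam" "frame_eigenvalues lam \<mu> \<nu> $ 5 = \<mu>" "frame_eigenvalues lam \<mu> \<nu> $ 6 = lam"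
  "frame_eigenvalues lam \<mu> \<nu> $ 7 = \<mu>"
  by (simp_all add: frame_eigenvalues_def vector_7)

lemma orthonormal_frame_rotated:
  assumes "orthonormal_frame b"
  shows "orthonormal_frame (rotated_frame b \<alpha> \<theta>)"
  using assms unfolding orthonormal_frame_7 rotated_frame_nth
  by (simp add: inner_add inner_diff_left inner_diff_right inner_commute[of "b$4" "b$3"]
      inner_commute[of "b$7" "b$6"] flip: power2_eq_square)

lemma matrix_inv_rot: "matrix_inv (rot \<alpha>) = transpose (rot \<alpha>)"
proof -
  let ?R = "rot \<alpha>"
  have "?R ** transpose ?R = mat 1" "transpose ?R ** ?R = mat 1"
    by (simp_all add: vec_eq_iff forall_2 matrix_matrix_mult_def sum_2 rot_def transpose_def mat_def
        flip: power2_eq_square)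
  then have "?R ** matrix_inv ?R = mat 1 \<and> matrix_inv ?R ** ?R = mat 1"
    unfolding matrix_inv_def by (intro someI) blast
  with \<open>?R ** transpose ?R = mat 1\<close> show ?thesis
    by (metis matrix_mul_assoc matrix_mul_lid matrix_mul_rid)
qed

lemma rot_conj_diag2_nth:
  fixes \<alpha> p q
  defines "N \<equiv> matrix_inv (rot \<alpha>) ** diag2 p q ** rot \<alpha>"
  shows "N $ 1 $ 1 = (cos \<alpha>)\<^sup>2 * p + (sin \<alpha>)\<^sup>2 * q"
    and "N $ 1 $ 2 = cos \<alpha> * sin \<alpha> * (q - p)"
    and "N $ 2 $ 1 = cos \<alpha> * sin \<alpha> * (q - p)"
    and "N $ 2 $ 2 = (sin \<alpha>)\<^sup>2 * p + (cos \<alpha>)\<^sup>2 * q"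
  unfolding N_def matrix_inv_rot
  by (simp_all add: matrix_matrix_mult_def sum_2 rot_def transpose_def diag2_def
      power2_eq_square algebra_simps)

lemma block_diag_columns:
  fixes b :: "'a::real_vector ^ 7"
  shows "(\<Sum>i\<in>UNIV. block_diag X A m B $ i $ 1 *\<^sub>R b $ i) = X$1$1 *\<^sub>R b$1 + X$2$1 *\<^sub>R b$2"
    "(\<Sum>i\<in>UNIV. block_diag X A m B $ i $ 2 *\<^sub>R b $ i) = X$1$2 *\<^sub>R b$1 + X$2$2 *\<^sub>R b$2"
    "(\<Sum>i\<in>UNIV. block_diag X A m B $ i $ 3 *\<^sub>R b $ i) = A$1$1 *\<^sub>R b$3 + A$2$1 *\<^sub>R b$4"
    "(\<Sum>i\<in>UNIV. block_diag X A m B $ i $ 4 *\<^sub>R b $ i) = A$1$2 *\<^sub>R b$3 + A$2$2 *\<^sub>R b$4"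
    "(\<Sum>i\<in>UNIV. block_diag X A m B $ i $ 5 *\<^sub>R b $ i) = m *\<^sub>R b$5"
    "(\<Sum>i\<in>UNIV. block_diag X A m B $ i $ 6 *\<^sub>R b $ i) = B$1$1 *\<^sub>R b$6 + B$2$1 *\<^sub>R b$7"
    "(\<Sum>i\<in>UNIV. block_diag X A m B $ i $ 7 *\<^sub>R b $ i) = B$1$2 *\<^sub>R b$6 + B$2$2 *\<^sub>R b$7"
  by (simp_all add: sum_7 block_diag_def vector_7)

lemma matrix_in_basis_eq_iff:
  fixes f :: "'a::euclidean_space ^ 7"
  assumes f: "orthonormal_frame f" "DIM('a) = 7"
  shows "matrix_in_basis f \<delta> = M \<longleftrightarrow> (\<forall>j. \<delta> (f $ j) = (\<Sum>i\<in>UNIV. M $ i $ j *\<^sub>R f $ i))"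
proof
  assume M: "matrix_in_basis f \<delta> = M"
  show "\<forall>j. \<delta> (f $ j) = (\<Sum>i\<in>UNIV. M $ i $ j *\<^sub>R f $ i)"
    using f orthonormal_frame_expand[OF f(1), of "\<delta> (f $ _)"]
    by (simp add: matrix_in_basis_nth[OF f] flip: M)
next
  assume "\<forall>j. \<delta> (f $ j) = (\<Sum>i\<in>UNIV. M $ i $ j *\<^sub>R f $ i)"
  then show "matrix_in_basis f \<delta> = M"
    by (simp add: vec_eq_iff matrix_in_basis_nth[OF f] inner_frame_sum[OF f(1)])
qed

text \<open>
  The case of one block of size 2: a symmetric block with eigenvalues \<open>p\<close>, \<open>q\<close> is diagonalised by the
  pair of vectors rotated by the angle with cosine \<open>c\<close> and sine \<open>s\<close>.
\<close>

lemma rotated_eigenvectors: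
  fixes x y :: "'a::real_vector"
  assumes lin: "linear \<delta>" and cs: "c\<^sup>2 + s\<^sup>2 = (1::real)"
  shows "\<delta> x = (c\<^sup>2 * p + s\<^sup>2 * q) *\<^sub>R x + (c * s * (q - p)) *\<^sub>R y \<and>
      \<delta> y = (c * s * (q - p)) *\<^sub>R x + (s\<^sup>2 * p + c\<^sup>2 * q) *\<^sub>R y \<longleftrightarrow>
    \<delta> (c *\<^sub>R x - s *\<^sub>R y) = p *\<^sub>R (c *\<^sub>R x - s *\<^sub>R y) \<and>
      \<delta> (s *\<^sub>R x + c *\<^sub>R y) = q *\<^sub>R (s *\<^sub>R x + c *\<^sub>R y)" (is "?L \<longleftrightarrow> ?R")
proof
  define P where "P = c\<^sup>2 * p + s\<^sup>2 * q"
  define Q where "Q = c * s * (q - p)"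
  define R where "R = s\<^sup>2 * p + c\<^sup>2 * q"
  assume ?L
  then have L: "\<delta> x = P *\<^sub>R x + Q *\<^sub>R y" "\<delta> y = Q *\<^sub>R x + R *\<^sub>R y"
    by (simp_all add: P_def Q_def R_def)
  have "\<delta> (c *\<^sub>R x - s *\<^sub>R y) = (c * P - s * Q) *\<^sub>R x - (s * R - c * Q) *\<^sub>R y"
    by (simp add: linear_diff[OF lin] linear_scale[OF lin] L algebra_simps)
  also have "c * P - s * Q = p * c" using cs unfolding P_def Q_def by algebra
  also have "s * R - c * Q = p * s" using cs unfolding R_def Q_def by algebra
  finally have 1: "\<delta> (c *\<^sub>R x - s *\<^sub>R y) = p *\<^sub>R (c *\<^sub>R x - s *\<^sub>R y)"
    by (simp add: algebra_simps)
  have "\<delta> (s *\<^sub>R x + c *\<^sub>R y) = (s * P + c * Q) *\<^sub>R x + (s * Q + c * R) *\<^sub>R y"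
    by (simp add: linear_add[OF lin] linear_scale[OF lin] L algebra_simps)
  also have "s * P + c * Q = q * s" using cs unfolding P_def Q_def by algebra
  also have "s * Q + c * R = q * c" using cs unfolding R_def Q_def by algebra
  finally show ?R using 1 by (simp add: algebra_simps)
next
  define w where "w = c *\<^sub>R x - s *\<^sub>R y"
  define w' where "w' = s *\<^sub>R x + c *\<^sub>R y"
  assume ?R
  then have R: "\<delta> w = p *\<^sub>R w" "\<delta> w' = q *\<^sub>R w'" by (simp_all add: w_def w'_def)
  have "c *\<^sub>R w + s *\<^sub>R w' = (c\<^sup>2 + s\<^sup>2) *\<^sub>R x" "c *\<^sub>R w' - s *\<^sub>R w = (c\<^sup>2 + s\<^sup>2) *\<^sub>R y"
    by (simp_all add: w_def w'_def algebra_simps power2_eq_square)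
  then have "x = c *\<^sub>R w + s *\<^sub>R w'" "y = c *\<^sub>R w' - s *\<^sub>R w" by (simp_all add: cs)
  then have "\<delta> x = c *\<^sub>R \<delta> w + s *\<^sub>R \<delta> w'" "\<delta> y = c *\<^sub>R \<delta> w' - s *\<^sub>R \<delta> w"
    by (metis linear_add[OF lin] linear_diff[OF lin] linear_scale[OF lin])+
  then show ?L unfolding R by (simp add: w_def w'_def algebra_simps power2_eq_square)
qed

text \<open>
  This turns a statement on matrices of size 7 into one on eigenvectors.  The existence part uses it
  from right to left, the uniqueness part from left to right.
\<close>

lemma matrix_eq_normal_form_iff:
  fixes b :: "'a::euclidean_space ^ 7"
  assumes b: "orthonormal_frame b" "DIM('a) = 7" and lin: "linear \<delta>"
  shows "matrix_in_basis b \<delta> = normal_form lam \<mu> \<nu> \<alpha> \<theta> \<longleftrightarrow>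
    (\<forall>i. \<delta> (rotated_frame b \<alpha> \<theta> $ i) = frame_eigenvalues lam \<mu> \<nu> $ i *\<^sub>R rotated_frame b \<alpha> \<theta> $ i)"
proof -
  have "matrix_in_basis b \<delta> = normal_form lam \<mu> \<nu> \<alpha> \<theta> \<longleftrightarrow>
    \<delta> (b$1) = \<nu> *\<^sub>R b$1 \<and> \<delta> (b$2) = \<nu> *\<^sub>R b$2 \<and> \<delta> (b$5) = \<mu> *\<^sub>R b$5 \<and>
    (\<delta> (b$3) = ((cos \<alpha>)\<^sup>2 * \<nu> + (sin \<alpha>)\<^sup>2 * lam) *\<^sub>R b$3 + (cos \<alpha> * sin \<alpha> * (lam - \<nu>)) *\<^sub>R b$4 \<and>
     \<delta> (b$4) = (cos \<alpha> * sin \<alpha> * (lam - \<nu>)) *\<^sub>R b$3 + ((sin \<alpha>)\<^sup>2 * \<nu> + (cos \<alpha>)\<^sup>2 * lam) *\<^sub>R b$4) \<and>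
    (\<delta> (b$6) = ((cos \<theta>)\<^sup>2 * lam + (sin \<theta>)\<^sup>2 * \<mu>) *\<^sub>R b$6 + (cos \<theta> * sin \<theta> * (\<mu> - lam)) *\<^sub>R b$7 \<and>
     \<delta> (b$7) = (cos \<theta> * sin \<theta> * (\<mu> - lam)) *\<^sub>R b$6 + ((sin \<theta>)\<^sup>2 * lam + (cos \<theta>)\<^sup>2 * \<mu>) *\<^sub>R b$7)"
    unfolding matrix_in_basis_eq_iff[OF b] forall_7 normal_form_def block_diag_columns
      rot_conj_diag2_nth by (simp add: mat_def) blast
  also have "\<dots> \<longleftrightarrow>
    (\<forall>i. \<delta> (rotated_frame b \<alpha> \<theta> $ i) = frame_eigenvalues lam \<mu> \<nu> $ i *\<^sub>R rotated_frame b \<alpha> \<theta> $ i)"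
    unfolding rotated_eigenvectors[OF lin sin_cos_squared_add2] forall_7
      rotated_frame_nth frame_eigenvalues_nth by blast
  finally show ?thesis .
qed

text \<open>
  The value \<open>\<delta> d \<bullet> d\<close> on the last basis vector \<open>d\<close>, from which \<open>\<theta>\<close> can be recovered.
\<close>

lemma normal_form_77: "normal_form lam \<mu> \<nu> \<alpha> \<theta> $ 7 $ 7 = (sin \<theta>)\<^sup>2 * lam + (cos \<theta>)\<^sup>2 * \<mu>"
  by (simp add: normal_form_def block_diag_def vector_7 rot_conj_diag2_nth)

lemma normal_form_in_Sym:
  fixes b :: "'a::euclidean_space ^ 7"
  assumes b: "orthonormal_frame b" "DIM('a) = 7"
    and ne: "lam \<noteq> \<mu>" "lam \<noteq> \<nu>" "\<mu> \<noteq> \<nu>"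
  shows "normal_form lam \<mu> \<nu> \<alpha> \<theta> \<in> Sym {(lam, 2), (\<mu>, 2), (\<nu>, 3)}"
proof -
  let ?M = "normal_form lam \<mu> \<nu> \<alpha> \<theta>"
  define f where "f = rotated_frame b \<alpha> \<theta>"
  define e where "e i = frame_eigenvalues lam \<mu> \<nu> $ i" for i
  have f: "orthonormal_frame f" "CARD(7) = DIM('a)"
    using orthonormal_frame_rotated[OF b(1)] b(2) by (simp_all add: f_def)
  have sym: "transpose ?M = ?M"
    by (simp add: vec_eq_iff forall_7 transpose_def normal_form_def block_diag_def vector_7
        rot_conj_diag2_nth mat_def)
  obtain \<delta> where \<delta>: "\<delta> \<in> sym_endo" "matrix_in_basis b \<delta> = ?M"
    using ex_sym_endo_of_matrix[OF b sym] by blast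
  then have lin: "linear \<delta>" by (simp add: sym_endo_def)
  have ev: "\<delta> (f $ i) = e i *\<^sub>R f $ i" for i
    using matrix_eq_normal_form_iff[OF b lin] \<delta>(2) unfolding f_def e_def by blast
  note space = frame_eigenspace[of f \<delta> e, OF f lin ev]
  have "{i. e i = lam} = {4, 6}" "{i. e i = \<mu>} = {5, 7}" "{i. e i = \<nu>} = {1, 2, 3}"
    using ne by (simp_all add: set_eq_iff forall_7 e_def frame_eigenvalues_nth)
  then have card: "card {i. e i = lam} = 2" "card {i. e i = \<mu>} = 2" "card {i. e i = \<nu>} = 3"
    by simp_all
  have "eigenvalue ?M l \<longleftrightarrow> l \<in> range e" for l
  proof -
    have "(\<exists>x. x \<noteq> 0 \<and> \<delta> x = l *\<^sub>R x) \<longleftrightarrow> l \<in> range e"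
    proof
      assume "l \<in> range e"
      then obtain i where "l = e i" by blast
      moreover have "f $ i \<noteq> 0" using f(1) unfolding orthonormal_frame_def by (metis inner_zero_left zero_neq_one)
      ultimately show "\<exists>x. x \<noteq> 0 \<and> \<delta> x = l *\<^sub>R x" using ev by blast
    next
      assume "\<exists>x. x \<noteq> 0 \<and> \<delta> x = l *\<^sub>R x"
      then obtain x where x: "x \<noteq> 0" "\<delta> x = l *\<^sub>R x" by blast
      show "l \<in> range e"
      proof (rule ccontr)
        assume "l \<notin> range e"
        then have "e i \<noteq> l" for i by blast
        then have "x \<bullet> f $ i = 0 \<bullet> f $ i" for i using space(1)[of x l] x(2) by auto
        then have "x = 0" by (rule orthonormal_frame_eqI[OF f])
        with x(1) show False ..
      qed
    qed
    then show ?thesis using matrix_in_basis_eigenspace(2)[OF b lin] \<delta>(2) by simp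
  qed
  moreover have "range e = {lam, \<mu>, \<nu>}"
    unfolding UNIV_7 by (auto simp: e_def frame_eigenvalues_nth)
  moreover have "dim (eigenspace ?M l) = card {i. e i = l}" for l
    using matrix_in_basis_eigenspace(1)[OF b lin] \<delta>(2) space(2) by simp
  ultimately have "eigen_dims ?M = {(lam, 2), (\<mu>, 2), (\<nu>, 3)}"
    unfolding eigen_dims_def using card by auto
  with sym show ?thesis by (simp add: Sym_def)
qed

section \<open>The parameters are invariants of the orbit\<close>

text \<open>
  Hadamard's inequality for unit vectors in dimension 3, from the identity of Lagrange applied
  twice: once for the cross product and once for its inner product with the third vector.
\<close>

lemma det3_sq_le:
  fixes x1 :: real
  assumes "x1\<^sup>2 + x2\<^sup>2 + x3\<^sup>2 = 1" "y1\<^sup>2 + y2\<^sup>2 + y3\<^sup>2 = 1" "t1\<^sup>2 + t2\<^sup>2 + t3\<^sup>2 = 1"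
  shows "(t1 * (x2 * y3 - x3 * y2) + t2 * (x3 * y1 - x1 * y3) + t3 * (x1 * y2 - x2 * y1))\<^sup>2 \<le> 1"
proof -
  define a1 where "a1 = x2 * y3 - x3 * y2"
  define a2 where "a2 = x3 * y1 - x1 * y3"
  define a3 where "a3 = x1 * y2 - x2 * y1"
  have "(a1\<^sup>2 + a2\<^sup>2 + a3\<^sup>2) + (x1 * y1 + x2 * y2 + x3 * y3)\<^sup>2 =
      (x1\<^sup>2 + x2\<^sup>2 + x3\<^sup>2) * (y1\<^sup>2 + y2\<^sup>2 + y3\<^sup>2)"
    unfolding a1_def a2_def a3_def by algebra
  then have a: "a1\<^sup>2 + a2\<^sup>2 + a3\<^sup>2 \<le> 1"
    unfolding assms using zero_le_power2[of "x1 * y1 + x2 * y2 + x3 * y3"] by linarith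
  have "(t1 * a1 + t2 * a2 + t3 * a3)\<^sup>2 +
      ((t1 * a2 - t2 * a1)\<^sup>2 + (t1 * a3 - t3 * a1)\<^sup>2 + (t2 * a3 - t3 * a2)\<^sup>2) =
      (t1\<^sup>2 + t2\<^sup>2 + t3\<^sup>2) * (a1\<^sup>2 + a2\<^sup>2 + a3\<^sup>2)"
    by algebra
  then have "(t1 * a1 + t2 * a2 + t3 * a3)\<^sup>2 \<le> a1\<^sup>2 + a2\<^sup>2 + a3\<^sup>2"
    unfolding assms by (smt (verit) mult_1 zero_le_power2)
  with a show ?thesis by (simp add: a1_def a2_def a3_def)
qed

context vector_product_space
begin

lemma inner_prd_combination:
  "((x1 *\<^sub>R u + x2 *\<^sub>R v + x3 *\<^sub>R w) \<odot> (y1 *\<^sub>R u + y2 *\<^sub>R v + y3 *\<^sub>R w)) \<bullet> t =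
    (x1 * y2 - x2 * y1) * ((u \<odot> v) \<bullet> t) + (x1 * y3 - x3 * y1) * ((u \<odot> w) \<bullet> t) +
    (x2 * y3 - x3 * y2) * ((v \<odot> w) \<bullet> t)"
  by (simp add: prd_linear prd_anticommute[of v u] prd_anticommute[of w u] prd_anticommute[of w v]
      inner_add_left algebra_simps)

text \<open>
  An alternating trilinear form on a space spanned by three vectors is a multiple of the determinant.
\<close>

lemma inner_prd_volume:
  "((x1 *\<^sub>R u + x2 *\<^sub>R v + x3 *\<^sub>R w) \<odot> (y1 *\<^sub>R u + y2 *\<^sub>R v + y3 *\<^sub>R w)) \<bullet>
      (t1 *\<^sub>R u + t2 *\<^sub>R v + t3 *\<^sub>R w) =
    (t1 * (x2 * y3 - x3 * y2) + t2 * (x3 * y1 - x1 * y3) + t3 * (x1 * y2 - x2 * y1)) *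
    ((u \<odot> v) \<bullet> w)"
proof -
  have "(u \<odot> w) \<bullet> v = - ((u \<odot> v) \<bullet> w)" "(v \<odot> w) \<bullet> u = (u \<odot> v) \<bullet> w"
    using inner_prd_swap[of u w v] inner_prd_cycle[of u v w] by simp_all
  then show ?thesis unfolding inner_prd_combination
    by (simp add: inner_add_right inner_prd_left inner_prd_right algebra_simps)
qed

end

context vector_product_space_7
begin

text \<open>
  For \<open>s \<noteq> 0\<close> the vectors \<open>u\<close>, \<open>v\<close>, \<open>w\<close> and their products span the orthogonal complement of
  \<open>(u v) z\<close>: modulo \<open>u\<close>, \<open>v\<close>, \<open>u v\<close>, the vectors \<open>w\<close>, \<open>u w\<close>, \<open>v w\<close> are nonzero multiples of \<open>z\<close>, \<open>u z\<close>,
  \<open>v z\<close>.  So the last basis vector depends, up to sign, only on the space spanned by \<open>u\<close>, \<open>v\<close>, \<open>w\<close>.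
\<close>

lemma distinguished_direction:
  fixes u v z :: 'a and c s :: real
  assumes s: "cayley_triple (\<odot>) (u, v, z)"
  defines "w \<equiv> c *\<^sub>R (u \<odot> v) - s *\<^sub>R z" and "d \<equiv> (u \<odot> v) \<odot> z"
  shows "d \<bullet> u = 0" "d \<bullet> v = 0" "d \<bullet> w = 0"
    and "(u \<odot> v) \<bullet> d = 0" "(u \<odot> w) \<bullet> d = 0" "(v \<odot> w) \<bullet> d = 0"
    and "\<lbrakk>s \<noteq> 0; y \<bullet> u = 0; y \<bullet> v = 0; y \<bullet> w = 0; (u \<odot> v) \<bullet> y = 0; (u \<odot> w) \<bullet> y = 0; (v \<odot> w) \<bullet> y = 0\<rbrakk>
      \<Longrightarrow> y = (y \<bullet> d) *\<^sub>R d"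
proof -
  define b where "b = cayley_basis (\<odot>) (u, v, z)"
  have b: "orthonormal_frame b" unfolding b_def by (rule orthonormal_frame_cayley_basis[OF s])
  have nth: "b $ 1 = u" "b $ 2 = v" "b $ 3 = u \<odot> v" "b $ 4 = z" "b $ 5 = u \<odot> z"
    "b $ 6 = v \<odot> z" "b $ 7 = d"
    by (simp_all add: b_def d_def cayley_basis_nth)
  note o = b[unfolded orthonormal_frame_7 nth]
  have uw: "u \<odot> w = - c *\<^sub>R v - s *\<^sub>R (u \<odot> z)" and vw: "v \<odot> w = c *\<^sub>R u - s *\<^sub>R (v \<odot> z)"
    by (simp_all add: w_def prd_linear prd_table[OF s])
  show "d \<bullet> u = 0" "d \<bullet> v = 0" "d \<bullet> w = 0" "(u \<odot> v) \<bullet> d = 0" "(u \<odot> w) \<bullet> d = 0" "(v \<odot> w) \<bullet> d = 0"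
    using o unfolding uw vw
    by (simp_all add: w_def inner_diff_left inner_diff_right inner_commute)
  assume y: "s \<noteq> 0" "y \<bullet> u = 0" "y \<bullet> v = 0" "y \<bullet> w = 0" "(u \<odot> v) \<bullet> y = 0" "(u \<odot> w) \<bullet> y = 0" "(v \<odot> w) \<bullet> y = 0"
  have "y \<bullet> (u \<odot> v) = 0" using y by (simp add: inner_commute)
  moreover from this have "y \<bullet> z = 0" using y by (simp add: w_def inner_diff_right)
  moreover have "y \<bullet> (u \<odot> z) = 0" "y \<bullet> (v \<odot> z) = 0"
    using y unfolding uw vw by (simp_all add: inner_diff_left inner_diff_right inner_commute)
  ultimately show "y = (y \<bullet> d) *\<^sub>R d"
    using orthonormal_frame_expand[OF b card_index, of y] y by (simp add: sum_7 nth)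
qed

text \<open>
  A normal form exhibits \<open>u\<close>, \<open>v\<close> and \<open>w\<close> as an orthonormal basis of the eigenspace for \<open>\<nu>\<close>, whose
  volume under \<open>(x y) \<bullet> t\<close> is \<open>cos \<alpha>\<close>.
\<close>

lemma nu_eigenspace_frame:
  fixes u v z :: 'a and \<alpha> :: real
  assumes \<delta>: "linear \<delta>" and s: "cayley_triple (\<odot>) (u, v, z)"
    and M: "matrix_in_basis (cayley_basis (\<odot>) (u, v, z)) \<delta> = normal_form lam \<mu> \<nu> \<alpha> \<theta>"
    and ne: "lam \<noteq> \<nu>" "\<mu> \<noteq> \<nu>"
  defines "w \<equiv> cos \<alpha> *\<^sub>R (u \<odot> v) - sin \<alpha> *\<^sub>R z"
  shows "\<delta> u = \<nu> *\<^sub>R u" "\<delta> v = \<nu> *\<^sub>R v" "\<delta> w = \<nu> *\<^sub>R w"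
    and "u \<bullet> u = 1" "v \<bullet> v = 1" "w \<bullet> w = 1" "(u \<odot> v) \<bullet> w = cos \<alpha>"
    and "\<delta> x = \<nu> *\<^sub>R x \<Longrightarrow> x = (x \<bullet> u) *\<^sub>R u + (x \<bullet> v) *\<^sub>R v + (x \<bullet> w) *\<^sub>R w"
    and "\<delta> x = \<nu> *\<^sub>R x \<Longrightarrow> x \<bullet> x = (x \<bullet> u)\<^sup>2 + (x \<bullet> v)\<^sup>2 + (x \<bullet> w)\<^sup>2"
proof -
  define b where "b = cayley_basis (\<odot>) (u, v, z)"
  define f where "f = rotated_frame b \<alpha> \<theta>"
  have b: "orthonormal_frame b" unfolding b_def by (rule orthonormal_frame_cayley_basis[OF s])
  have f: "orthonormal_frame f" unfolding f_def by (rule orthonormal_frame_rotated[OF b])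
  have nth: "f $ 1 = u" "f $ 2 = v" "f $ 3 = w"
    by (simp_all add: f_def rotated_frame_nth b_def cayley_basis_nth w_def)
  have ev: "\<delta> (f $ i) = frame_eigenvalues lam \<mu> \<nu> $ i *\<^sub>R f $ i" for i
    using matrix_eq_normal_form_iff[OF b dim_7 \<delta>] M unfolding f_def b_def by blast
  show "\<delta> u = \<nu> *\<^sub>R u" "\<delta> v = \<nu> *\<^sub>R v" "\<delta> w = \<nu> *\<^sub>R w"
    using ev[of 1] ev[of 2] ev[of 3] by (simp_all add: nth frame_eigenvalues_nth)
  show "u \<bullet> u = 1" "v \<bullet> v = 1" "w \<bullet> w = 1"
    using f unfolding orthonormal_frame_7 nth by simp_all
  have "(u \<odot> v) \<bullet> (u \<odot> v) = 1" "(u \<odot> v) \<bullet> z = 0"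
    using s by (simp_all add: cayley_triple_def orthonormal_4)
  then show "(u \<odot> v) \<bullet> w = cos \<alpha>" by (simp add: w_def inner_diff_right)
  have 0: "x \<bullet> f $ 4 = 0" "x \<bullet> f $ 5 = 0" "x \<bullet> f $ 6 = 0" "x \<bullet> f $ 7 = 0" if "\<delta> x = \<nu> *\<^sub>R x"
    using frame_eigenspace(1)[of f \<delta> "\<lambda>i. frame_eigenvalues lam \<mu> \<nu> $ i", OF f card_index \<delta> ev] that ne
    by (simp_all add: forall_7 frame_eigenvalues_nth)
  show "x = (x \<bullet> u) *\<^sub>R u + (x \<bullet> v) *\<^sub>R v + (x \<bullet> w) *\<^sub>R w" if "\<delta> x = \<nu> *\<^sub>R x"
    using orthonormal_frame_expand[OF f card_index, of x] 0[OF that] by (simp add: sum_7 nth)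
  show "x \<bullet> x = (x \<bullet> u)\<^sup>2 + (x \<bullet> v)\<^sup>2 + (x \<bullet> w)\<^sup>2" if "\<delta> x = \<nu> *\<^sub>R x"
    using inner_frame_coords[OF f card_index, of x x] 0[OF that]
    by (simp add: frame_coords_def inner_vec_def sum_7 nth power2_eq_square)
qed

text \<open>
  The triple coming from \<open>t\<close> spans the same eigenspace as the one coming from \<open>s\<close>, so its volume
  \<open>cos \<alpha>'\<close> is \<open>cos \<alpha>\<close> times a determinant of unit vectors.  By symmetry the cosines agree as soon as
  both are nonnegative.
\<close>

lemma normal_form_cos_le:
  assumes \<delta>: "linear \<delta>" and ne: "lam \<noteq> \<nu>" "\<mu> \<noteq> \<nu>"
    and s: "cayley_triple (\<odot>) s" "matrix_in_basis (cayley_basis (\<odot>) s) \<delta> = normal_form lam \<mu> \<nu> \<alpha> \<theta>"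
    and t: "cayley_triple (\<odot>) t" "matrix_in_basis (cayley_basis (\<odot>) t) \<delta> = normal_form lam \<mu> \<nu> \<alpha>' \<theta>'"
    and "0 \<le> cos \<alpha>"
  shows "cos \<alpha>' \<le> cos \<alpha>"
proof -
  obtain u v z where s': "s = (u, v, z)" by (cases s)
  obtain u' v' z' where t': "t = (u', v', z')" by (cases t)
  define w where "w = cos \<alpha> *\<^sub>R (u \<odot> v) - sin \<alpha> *\<^sub>R z"
  define w' where "w' = cos \<alpha>' *\<^sub>R (u' \<odot> v') - sin \<alpha>' *\<^sub>R z'"
  note E = nu_eigenspace_frame[OF \<delta> s[unfolded s'] ne, folded w_def]
  note E' = nu_eigenspace_frame[OF \<delta> t[unfolded t'] ne, folded w'_def]
  define D where "D = (w' \<bullet> u) * ((u' \<bullet> v) * (v' \<bullet> w) - (u' \<bullet> w) * (v' \<bullet> v)) +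
    (w' \<bullet> v) * ((u' \<bullet> w) * (v' \<bullet> u) - (u' \<bullet> u) * (v' \<bullet> w)) +
    (w' \<bullet> w) * ((u' \<bullet> u) * (v' \<bullet> v) - (u' \<bullet> v) * (v' \<bullet> u))"
  have "cos \<alpha>' = (u' \<odot> v') \<bullet> w'" by (simp add: E')
  also have "\<dots> = (((u' \<bullet> u) *\<^sub>R u + (u' \<bullet> v) *\<^sub>R v + (u' \<bullet> w) *\<^sub>R w) \<odot>
      ((v' \<bullet> u) *\<^sub>R u + (v' \<bullet> v) *\<^sub>R v + (v' \<bullet> w) *\<^sub>R w)) \<bullet>
      ((w' \<bullet> u) *\<^sub>R u + (w' \<bullet> v) *\<^sub>R v + (w' \<bullet> w) *\<^sub>R w)"
    unfolding E(8)[OF E'(1), symmetric] E(8)[OF E'(2), symmetric] E(8)[OF E'(3), symmetric] ..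
  also have "\<dots> = D * cos \<alpha>"
    unfolding inner_prd_volume by (simp add: D_def E)
  finally have "cos \<alpha>' = D * cos \<alpha>" .
  have "(u' \<bullet> u)\<^sup>2 + (u' \<bullet> v)\<^sup>2 + (u' \<bullet> w)\<^sup>2 = 1"
    "(v' \<bullet> u)\<^sup>2 + (v' \<bullet> v)\<^sup>2 + (v' \<bullet> w)\<^sup>2 = 1"
    "(w' \<bullet> u)\<^sup>2 + (w' \<bullet> v)\<^sup>2 + (w' \<bullet> w)\<^sup>2 = 1"
    using E(9)[OF E'(1)] E(9)[OF E'(2)] E(9)[OF E'(3)] E'(4-6) by simp_all
  then have "D\<^sup>2 \<le> 1" unfolding D_def by (rule det3_sq_le)
  then have "D \<le> 1" by (simp add: abs_square_le_1 flip: abs_le_iff)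
  with \<open>cos \<alpha>' = D * cos \<alpha>\<close> show ?thesis using mult_right_mono[of D 1 "cos \<alpha>"] \<open>0 \<le> cos \<alpha>\<close> by simp
qed

text \<open>
  The last vectors \<open>d\<close> and \<open>d'\<close> of the two Cayley bases are both orthogonal to the eigenspace for
  \<open>\<nu>\<close> and its products.  As \<open>sin \<alpha> \<noteq> 0\<close>, this determines them up to sign, so they give the same
  value \<open>\<delta> d \<bullet> d\<close>.
\<close>

lemma normal_form_cos_sq_eq:
  assumes \<delta>: "linear \<delta>" and ne: "lam \<noteq> \<mu>" "lam \<noteq> \<nu>" "\<mu> \<noteq> \<nu>"
    and s: "cayley_triple (\<odot>) s" "matrix_in_basis (cayley_basis (\<odot>) s) \<delta> = normal_form lam \<mu> \<nu> \<alpha> \<theta>"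
    and t: "cayley_triple (\<odot>) t" "matrix_in_basis (cayley_basis (\<odot>) t) \<delta> = normal_form lam \<mu> \<nu> \<alpha>' \<theta>'"
    and "sin \<alpha> \<noteq> 0"
  shows "(cos \<theta>')\<^sup>2 = (cos \<theta>)\<^sup>2"
proof -
  obtain u v z where s': "s = (u, v, z)" by (cases s)
  obtain u' v' z' where t': "t = (u', v', z')" by (cases t)
  define w where "w = cos \<alpha> *\<^sub>R (u \<odot> v) - sin \<alpha> *\<^sub>R z"
  define w' where "w' = cos \<alpha>' *\<^sub>R (u' \<odot> v') - sin \<alpha>' *\<^sub>R z'"
  define d where "d = (u \<odot> v) \<odot> z"
  define d' where "d' = (u' \<odot> v') \<odot> z'"
  note E = nu_eigenspace_frame[OF \<delta> s[unfolded s'] ne(2,3), folded w_def]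
  note E' = nu_eigenspace_frame[OF \<delta> t[unfolded t'] ne(2,3), folded w'_def]
  have dir: "y = (y \<bullet> d) *\<^sub>R d" if "y \<bullet> u = 0" "y \<bullet> v = 0" "y \<bullet> w = 0"
    "(u \<odot> v) \<bullet> y = 0" "(u \<odot> w) \<bullet> y = 0" "(v \<odot> w) \<bullet> y = 0" for y
    using distinguished_direction(7)[OF s(1)[unfolded s'] \<open>sin \<alpha> \<noteq> 0\<close>] that
    unfolding w_def d_def by blast
  have dir': "d' \<bullet> u' = 0" "d' \<bullet> v' = 0" "d' \<bullet> w' = 0"
    "(u' \<odot> v') \<bullet> d' = 0" "(u' \<odot> w') \<bullet> d' = 0" "(v' \<odot> w') \<bullet> d' = 0"
    unfolding w'_def d'_def by (intro distinguished_direction t(1)[unfolded t'])+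
  have perp: "d' \<bullet> x = 0" if "\<delta> x = \<nu> *\<^sub>R x" for x
    by (subst E'(8)[OF that]) (simp add: inner_add_right dir')
  have perp2: "(x \<odot> y) \<bullet> d' = 0" if "\<delta> x = \<nu> *\<^sub>R x" "\<delta> y = \<nu> *\<^sub>R y" for x y
    by (subst E'(8)[OF that(1)], subst E'(8)[OF that(2)]) (simp add: inner_prd_combination dir')
  have dd: "d' = (d' \<bullet> d) *\<^sub>R d"
    by (intro dir perp perp2 E)
  have frame: "orthonormal_frame (cayley_basis (\<odot>) s)" "orthonormal_frame (cayley_basis (\<odot>) t)"
    using s(1) t(1) by (simp_all add: orthonormal_frame_cayley_basis)
  have nth: "cayley_basis (\<odot>) s $ 7 = d" "cayley_basis (\<odot>) t $ 7 = d'"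
    by (simp_all add: s' t' d_def d'_def cayley_basis_nth)
  have unit: "d \<bullet> d = 1" "d' \<bullet> d' = 1"
    using frame unfolding orthonormal_frame_7 nth by simp_all
  have d: "\<delta> d \<bullet> d = (sin \<theta>)\<^sup>2 * lam + (cos \<theta>)\<^sup>2 * \<mu>" "\<delta> d' \<bullet> d' = (sin \<theta>')\<^sup>2 * lam + (cos \<theta>')\<^sup>2 * \<mu>"
    using matrix_in_basis_nth[OF frame(1) dim_7, of \<delta> 7 7] matrix_in_basis_nth[OF frame(2) dim_7, of \<delta> 7 7]
    by (simp_all add: s(2) t(2) nth normal_form_77)
  define r where "r = d' \<bullet> d"
  have d': "d' = r *\<^sub>R d" using dd by (simp add: r_def)
  have "r * r = 1" using unit unfolding d' by simp
  then have "\<delta> d' \<bullet> d' = \<delta> d \<bullet> d"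
    unfolding d' by (simp add: linear_scale[OF \<delta>] flip: mult.assoc)
  then have "(lam - \<mu>) * ((cos \<theta>')\<^sup>2 - (cos \<theta>)\<^sup>2) = 0"
    unfolding d sin_squared_eq by (simp add: algebra_simps)
  with ne(1) show ?thesis by simp
qed

end

definition parameter_range :: "(real \<times> real) set" where
  "parameter_range = {0<..pi/2} \<times> {0..pi/2} \<union> {(0, 0)}"

context vector_product_space_7
begin

lemma normal_form_parameters_unique:
  assumes \<delta>: "linear \<delta>" and ne: "lam \<noteq> \<mu>" "lam \<noteq> \<nu>" "\<mu> \<noteq> \<nu>"
    and s: "cayley_triple (\<odot>) s" "matrix_in_basis (cayley_basis (\<odot>) s) \<delta> = normal_form lam \<mu> \<nu> \<alpha> \<theta>"
    and t: "cayley_triple (\<odot>) t" "matrix_in_basis (cayley_basis (\<odot>) t) \<delta> = normal_form lam \<mu> \<nu> \<alpha>' \<theta>'"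
    and range: "(\<alpha>, \<theta>) \<in> parameter_range" "(\<alpha>', \<theta>') \<in> parameter_range"
  shows "\<alpha> = \<alpha>'" "\<theta> = \<theta>'"
proof -
  have bounds: "0 \<le> \<alpha>" "\<alpha> \<le> pi/2" "0 \<le> \<alpha>'" "\<alpha>' \<le> pi/2" "0 \<le> \<theta>" "\<theta> \<le> pi/2" "0 \<le> \<theta>'" "\<theta>' \<le> pi/2"
    using range by (auto simp: parameter_range_def)
  have cos: "0 \<le> cos \<alpha>" "0 \<le> cos \<alpha>'" "0 \<le> cos \<theta>" "0 \<le> cos \<theta>'"
    using bounds by (auto intro!: cos_ge_zero)
  have "cos \<alpha> = cos \<alpha>'"
    using normal_form_cos_le[OF \<delta> ne(2,3) s t cos(1)] normal_form_cos_le[OF \<delta> ne(2,3) t s cos(2)]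
    by simp
  then show \<alpha>: "\<alpha> = \<alpha>'" by (rule cos_inj_pi[rotated 4]) (use bounds in auto)
  show "\<theta> = \<theta>'"
  proof (cases "\<alpha> = 0")
    case True
    then show ?thesis using range \<alpha> by (auto simp: parameter_range_def)
  next
    case False
    then have "sin \<alpha> \<noteq> 0" using bounds sin_gt_zero[of \<alpha>] pi_gt_zero by (smt (verit) field_sum_of_halves)
    then have "(cos \<theta>')\<^sup>2 = (cos \<theta>)\<^sup>2" by (rule normal_form_cos_sq_eq[OF \<delta> ne s t])
    then have "cos \<theta> = cos \<theta>'" using cos by simp
    then show ?thesis by (rule cos_inj_pi[rotated 4]) (use bounds in auto)
  qed
qed

end

section \<open>Existence of an adapted Cayley basis\<close>

lemma ex_unit_orthogonal:
  fixes T :: "'a::euclidean_space set"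
  assumes T: "subspace T" and B: "finite B" "card B < dim T"
  obtains x where "x \<in> T" "x \<bullet> x = 1" "\<And>b. b \<in> B \<Longrightarrow> x \<bullet> b = 0"
proof -
  have "\<exists>y\<in>T. \<forall>w\<in>T. (b - y) \<bullet> w = 0" for b
    using orthogonal_subspace_decomp_exists[of T b] T
    by (metis add_diff_cancel_left' orthogonal_def span_eq_iff)
  then obtain p where p: "\<And>b. p b \<in> T" "\<And>b w. w \<in> T \<Longrightarrow> (b - p b) \<bullet> w = 0" by metis
  have "dim (span (p ` B)) \<le> card B"
    using B(1) by (metis card_image_le dim_le_card dim_span finite_imageI le_trans order_refl)
  then have "span (p ` B) \<noteq> span T" using B(2) by (metis dim_span not_less)
  moreover have "span (p ` B) \<subseteq> span T" using p(1) by (intro span_mono) auto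
  ultimately obtain x where x: "x \<noteq> 0" "x \<in> span T" "\<And>y. y \<in> span (p ` B) \<Longrightarrow> orthogonal x y"
    using orthogonal_to_subspace_exists_gen[of "p ` B" T] by blast
  have xT: "x \<in> T" using x(2) T span_eq_iff[of T] by blast
  have "x \<bullet> b = 0" if "b \<in> B" for b
  proof -
    have "x \<bullet> p b = 0" using x(3) that by (simp add: orthogonal_def span_base)
    then show ?thesis using p(2)[OF xT, of b] by (simp add: inner_diff_left inner_diff_right inner_commute)
  qed
  then show thesis
    using that[of "x /\<^sub>R norm x"] xT x(1) T
    by (simp add: subspace_scale dot_square_norm power2_eq_square)
qed

text \<open>
  The orthogonal complement of \<open>N + L\<close> contains \<open>M\<close> and has the same dimension.
\<close>

lemma orthogonal_complement_sum:
  fixes N L M :: "'a::euclidean_space set"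
  assumes sub: "subspace N" "subspace L" "subspace M"
    and NL: "\<And>x y. x \<in> N \<Longrightarrow> y \<in> L \<Longrightarrow> x \<bullet> y = 0"
    and NM: "\<And>x y. x \<in> N \<Longrightarrow> y \<in> M \<Longrightarrow> x \<bullet> y = 0"
    and LM: "\<And>x y. x \<in> L \<Longrightarrow> y \<in> M \<Longrightarrow> x \<bullet> y = 0"
    and dim: "dim N + dim L + dim M = DIM('a)"
    and x: "\<And>y. y \<in> N \<Longrightarrow> x \<bullet> y = 0" "\<And>y. y \<in> L \<Longrightarrow> x \<bullet> y = 0"
  shows "x \<in> M"
proof -
  define S where "S = {a + b | a b. a \<in> N \<and> b \<in> L}"
  define C where "C = {y \<in> UNIV. \<forall>x\<in>S. orthogonal x y}"
  have S: "subspace S" unfolding S_def by (rule subspace_sums[OF sub(1,2)])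
  have "N \<inter> L = {0}"
    using sub NL by (auto simp: subspace_0) (metis inner_eq_zero_iff)
  then have "dim S = dim N + dim L"
    using dim_sums_Int[OF sub(1,2)] by (simp add: S_def)
  moreover have "dim C + dim S = DIM('a)"
    unfolding C_def using dim_subspace_orthogonal_to_vectors[OF S subspace_UNIV] by simp
  ultimately have "dim C = dim M" using dim by simp
  moreover have "M \<subseteq> C"
    using NM LM by (auto simp: C_def S_def orthogonal_def inner_add_left)
  moreover have "subspace C"
    by (auto simp: C_def subspace_def orthogonal_def inner_add_right)
  ultimately have "M = C" using sub(3) by (intro subspace_dim_equal) auto
  moreover have "x \<in> C"
    using x by (auto simp: C_def S_def orthogonal_def inner_add_right inner_commute[of _ x])
  ultimately show ?thesis by simp
qed

text \<open>
  The eigenspaces enter the construction only as mutually orthogonal subspaces of dimensions 3, 2, 2.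
\<close>

locale eigenspace_decomposition = vector_product_space_7 prd
  for prd :: "'a::euclidean_space \<Rightarrow> 'a \<Rightarrow> 'a"  (infixl \<open>\<odot>\<close> 75) +
  fixes N L M :: "'a set"
  assumes subspaces: "subspace N" "subspace L" "subspace M"
    and dims: "dim N = 3" "dim L = 2" "dim M = 2"
    and perp_NL: "\<And>x y. x \<in> N \<Longrightarrow> y \<in> L \<Longrightarrow> x \<bullet> y = 0"
    and perp_NM: "\<And>x y. x \<in> N \<Longrightarrow> y \<in> M \<Longrightarrow> x \<bullet> y = 0"
    and perp_LM: "\<And>x y. x \<in> L \<Longrightarrow> y \<in> M \<Longrightarrow> x \<bullet> y = 0"
begin

lemma perp_MN: "x \<in> M \<Longrightarrow> y \<in> N \<Longrightarrow> x \<bullet> y = 0"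
  and perp_ML: "x \<in> M \<Longrightarrow> y \<in> L \<Longrightarrow> x \<bullet> y = 0"
  using perp_NM[of y x] perp_LM[of y x] by (simp_all add: inner_commute)

lemma in_L_if_perp: "(\<And>y. y \<in> N \<Longrightarrow> x \<bullet> y = 0) \<Longrightarrow> (\<And>y. y \<in> M \<Longrightarrow> x \<bullet> y = 0) \<Longrightarrow> x \<in> L"
  using subspaces dims perp_NL perp_NM perp_ML dim_7
  by (intro orthogonal_complement_sum[of N M L x]) auto

lemma decomposition_swap: "eigenspace_decomposition prd N M L"
  using subspaces dims perp_NL perp_NM perp_ML
  by unfold_locales auto

text \<open>
  A basis of \<open>N\<close> together with its products imposes at most six linear conditions in dimension 7.  If
  \<open>N\<close> is closed under the product there are only three, and then \<open>d\<close> can be taken in \<open>M\<close>; this extra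
  freedom is what makes \<open>\<theta>\<close> vanish together with \<open>\<alpha>\<close>.
\<close>

lemma ex_direction:
  obtains d where "d \<bullet> d = 1" "\<And>x. x \<in> N \<Longrightarrow> d \<bullet> x = 0"
    "\<And>x y. x \<in> N \<Longrightarrow> y \<in> N \<Longrightarrow> (x \<odot> y) \<bullet> d = 0"
    "(\<forall>x\<in>N. \<forall>y\<in>N. x \<odot> y \<in> N) \<longrightarrow> d \<in> M"
proof (cases "\<forall>x\<in>N. \<forall>y\<in>N. x \<odot> y \<in> N")
  case True
  obtain d where "d \<in> M" "d \<bullet> d = 1"
    by (rule ex_unit_orthogonal[OF subspaces(3), of "{}"]) (auto simp: dims)
  then show thesis using True perp_MN perp_NM by (intro that[of d]) auto
next
  case False
  obtain B where B: "B \<subseteq> N" "independent B" "N \<subseteq> span B" "card B = 3"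
    using basis_exists[of N] dims by metis
  then obtain a b c where abc: "B = {a, b, c}" by (metis card_3_iff)
  have comb: "\<exists>p q r. x = p *\<^sub>R a + q *\<^sub>R b + r *\<^sub>R c" if "x \<in> N" for x
  proof -
    have "x \<in> span {a, b, c}" using that B(3) abc by blast
    then obtain p q r where "x - p *\<^sub>R a - q *\<^sub>R b - r *\<^sub>R c = 0"
      by (auto simp: span_breakdown_eq)
    then have "x = p *\<^sub>R a + q *\<^sub>R b + r *\<^sub>R c" by (simp add: algebra_simps)
    then show ?thesis by blast
  qed
  let ?S = "{a, b, c, a \<odot> b, a \<odot> c, b \<odot> c}"
  have "card ?S \<le> card (set [a, b, c, a \<odot> b, a \<odot> c, b \<odot> c])" by simp
  also have "\<dots> \<le> 6" using card_length[of "[a, b, c, a \<odot> b, a \<odot> c, b \<odot> c]"] by simp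
  finally obtain d where d: "d \<bullet> d = 1" "\<And>y. y \<in> ?S \<Longrightarrow> d \<bullet> y = 0"
    by (rule_tac ex_unit_orthogonal[of UNIV ?S]) (auto simp: dim_7)
  show thesis
  proof (rule that[OF d(1)])
    show "d \<bullet> x = 0" if "x \<in> N" for x
      using comb[OF that] d(2) by (auto simp: inner_add_right)
    have "(a \<odot> b) \<bullet> d = 0" "(a \<odot> c) \<bullet> d = 0" "(b \<odot> c) \<bullet> d = 0"
      using d(2) by (simp_all add: inner_commute[of _ d])
    then show "(x \<odot> y) \<bullet> d = 0" if "x \<in> N" "y \<in> N" for x y
      using comb[OF that(1)] comb[OF that(2)] by (auto simp: inner_prd_combination)
  qed (use False in blast)
qed

text \<open>
  For \<open>w \<in> N\<close> the product \<open>d w\<close> is orthogonal to \<open>N\<close>, so it lies in \<open>L\<close> as soon as it is orthogonal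
  to \<open>M\<close>.  These are two linear conditions on \<open>w\<close>, which ranges over a space of dimension 3.
\<close>

lemma ex_unit_into_L:
  assumes d: "\<And>x y. x \<in> N \<Longrightarrow> y \<in> N \<Longrightarrow> (x \<odot> y) \<bullet> d = 0"
  obtains w where "w \<in> N" "w \<bullet> w = 1" "d \<odot> w \<in> L"
proof -
  obtain B where B: "B \<subseteq> M" "independent B" "M \<subseteq> span B" "card B = 2"
    using basis_exists[of M] dims by metis
  have "finite B" using B(4) by (metis card.infinite zero_neq_numeral)
  then have "card ((\<odot>) d ` B) < dim N"
    using card_image_le[of B "(\<odot>) d"] B(4) dims by simp
  then obtain w where w: "w \<in> N" "w \<bullet> w = 1" "\<And>b. b \<in> (\<odot>) d ` B \<Longrightarrow> w \<bullet> b = 0"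
    using ex_unit_orthogonal[OF subspaces(1), of "(\<odot>) d ` B"] \<open>finite B\<close> by blast
  have "d \<odot> w \<in> L"
  proof (rule in_L_if_perp)
    show "(d \<odot> w) \<bullet> y = 0" if "y \<in> N" for y
      using d[OF w(1) that] by (simp add: inner_prd_cycle[of d w y])
    have "orthogonal (d \<odot> w) b" if "b \<in> B" for b
      using w(3)[of "d \<odot> b"] that unfolding orthogonal_def inner_prd_swap[of d w b]
      by (simp add: inner_commute)
    then show "(d \<odot> w) \<bullet> y = 0" if "y \<in> M" for y
      using that B(3) by (metis orthogonal_def orthogonal_to_span subsetD)
  qed
  with w(1,2) show thesis by (rule that)
qed

text \<open>
  The condition that the rotated Cayley basis of \<open>(u, v, z)\<close> consists of eigenvectors, expressed by
  the subspaces alone.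
\<close>

definition adapted :: "'a \<Rightarrow> 'a \<Rightarrow> 'a \<Rightarrow> real \<Rightarrow> real \<Rightarrow> bool" where
  "adapted u v z \<alpha> \<theta> \<longleftrightarrow> cayley_triple (\<odot>) (u, v, z) \<and> u \<in> N \<and> v \<in> N \<and>
    cos \<alpha> *\<^sub>R (u \<odot> v) - sin \<alpha> *\<^sub>R z \<in> N \<and> sin \<alpha> *\<^sub>R (u \<odot> v) + cos \<alpha> *\<^sub>R z \<in> L \<and> u \<odot> z \<in> M \<and>
    cos \<theta> *\<^sub>R (v \<odot> z) - sin \<theta> *\<^sub>R ((u \<odot> v) \<odot> z) \<in> L \<and>
    sin \<theta> *\<^sub>R (v \<odot> z) + cos \<theta> *\<^sub>R ((u \<odot> v) \<odot> z) \<in> M"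

text \<open>
  The heart of the existence proof.  Taking \<open>z = d (u v)\<close> turns \<open>d\<close> into the last vector of the Cayley
  basis, and the two sign conditions put \<open>\<alpha>\<close> into the first quadrant.  The angle \<open>\<theta>\<close> is that of the
  line of \<open>L\<close> orthogonal to \<open>d w\<close>; replacing \<open>(u, v)\<close> by \<open>(- u, - v)\<close> reflects it while leaving \<open>u v\<close>,
  \<open>z\<close> and \<open>\<alpha>\<close> unchanged.
\<close>

lemma adapted_of_direction:
  assumes d: "d \<bullet> d = 1" "\<And>x. x \<in> N \<Longrightarrow> d \<bullet> x = 0"
      "\<And>x y. x \<in> N \<Longrightarrow> y \<in> N \<Longrightarrow> (x \<odot> y) \<bullet> d = 0"
    and closed: "(\<And>x y. x \<in> N \<Longrightarrow> y \<in> N \<Longrightarrow> x \<odot> y \<in> N) \<Longrightarrow> d \<in> M"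
    and N: "u \<in> N" "v \<in> N" "w \<in> N"
    and o: "u \<bullet> u = 1" "v \<bullet> v = 1" "w \<bullet> w = 1" "u \<bullet> v = 0" "u \<bullet> w = 0" "v \<bullet> w = 0"
    and dw: "d \<odot> w \<in> L" and dv: "d \<odot> v \<in> M"
    and sign: "0 \<le> (u \<odot> v) \<bullet> w" "(d \<odot> (u \<odot> v)) \<bullet> w \<le> 0"
  shows "\<exists>u v z \<alpha> \<theta>. (\<alpha>, \<theta>) \<in> parameter_range \<and> adapted u v z \<alpha> \<theta>"
proof -
  define a where "a = u \<odot> v"
  define z where "z = d \<odot> a"
  have da: "d \<bullet> a = 0" "a \<bullet> d = 0" using d(3)[OF N(1,2)] by (simp_all add: a_def inner_commute)
  have dN: "d \<bullet> u = 0" "d \<bullet> v = 0" "d \<bullet> w = 0" "u \<bullet> d = 0" "v \<bullet> d = 0" "w \<bullet> d = 0"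
    using d(2)[OF N(1)] d(2)[OF N(2)] d(2)[OF N(3)] by (simp_all add: inner_commute)
  have aa: "a \<bullet> a = 1" using o by (simp add: a_def inner_prd_prd)
  have ua: "u \<bullet> a = 0" "v \<bullet> a = 0" "a \<bullet> u = 0" "a \<bullet> v = 0"
    by (simp_all add: a_def inner_prd_left inner_prd_right inner_commute[of _ "u \<odot> v"])
  have mult: "u \<odot> a = - v" "v \<odot> a = u"
    using o prd_prd_same[of u v] prd_prd_same[of v u]
    by (simp_all add: a_def prd_anticommute[of u v] prd_linear inner_commute)
  have uz: "u \<odot> z = d \<odot> v" and vz: "v \<odot> z = - (d \<odot> u)" and az: "a \<odot> z = d"
    by (simp_all add: z_def prd_prd_swap[of _ d] mult da dN ua aa prd_linear)
  have dz: "d \<odot> z = - a" by (simp add: z_def prd_prd_same d(1) da)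
  have zz: "z \<bullet> z = 1" by (simp add: z_def inner_prd_prd d(1) aa da)
  have "z \<bullet> u = 0" "z \<bullet> v = 0" "z \<bullet> a = 0"
    using mult prd_anticommute[of a u] prd_anticommute[of a v]
    by (simp_all add: z_def inner_prd_cycle[of d a] dN)
  then have triple: "cayley_triple (\<odot>) (u, v, z)"
    using o aa ua zz by (simp add: cayley_triple_def orthonormal_4 a_def inner_commute)
  define b where "b = cayley_basis (\<odot>) (u, v, z)"
  have b: "orthonormal_frame b" unfolding b_def by (rule orthonormal_frame_cayley_basis[OF triple])
  have nth: "b $ 1 = u" "b $ 2 = v" "b $ 3 = a" "b $ 4 = z" "b $ 5 = d \<odot> v" "b $ 6 = v \<odot> z" "b $ 7 = d"
    using az by (simp_all add: b_def cayley_basis_nth a_def uz)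
  have dNN: "(d \<odot> x) \<bullet> y = 0" if "x \<in> N" "y \<in> N" for x y
    using d(3)[OF that] by (simp add: inner_prd_cycle[of d x y])
  have N_vz: "x \<bullet> (v \<odot> z) = 0" "x \<bullet> (d \<odot> v) = 0" if "x \<in> N" for x
    using dNN[OF N(1) that] dNN[OF N(2) that] by (simp_all add: vz inner_commute)
  define c where "c = a \<bullet> w"
  define s where "s = - (z \<bullet> w)"
  have w: "w = c *\<^sub>R a - s *\<^sub>R z"
    using orthonormal_frame_expand[OF b card_index, of w] N_vz[OF N(3)] o dN
    by (simp add: sum_7 nth c_def s_def inner_commute)
  have "c\<^sup>2 + s\<^sup>2 = 1"
    using inner_frame_coords[OF b card_index, of w w] N_vz[OF N(3)] o dN
    by (simp add: frame_coords_def inner_vec_def sum_7 nth c_def s_def inner_commute power2_eq_square)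
  then obtain \<alpha> where \<alpha>: "0 \<le> \<alpha>" "\<alpha> \<le> pi/2" "c = cos \<alpha>" "s = sin \<alpha>"
    using sincos_total_pi_half[of c s] sign by (auto simp: c_def s_def a_def z_def)
  have w_N: "cos \<alpha> *\<^sub>R a - sin \<alpha> *\<^sub>R z \<in> N" using N(3) w \<alpha> by simp
  have dw_eq: "d \<odot> w = sin \<alpha> *\<^sub>R a + cos \<alpha> *\<^sub>R z"
    unfolding w by (simp add: prd_linear dz \<alpha>) (simp add: z_def add.commute)

  \<comment> \<open>Unit vectors \<open>l\<close> and \<open>m\<close> that complete \<open>d w\<close> to a basis of \<open>L\<close> and \<open>d v\<close> to a basis of \<open>M\<close>.
      Both lie in the plane of \<open>v z\<close> and \<open>d\<close>.\<close>
  obtain l where l: "l \<in> L" "l \<bullet> l = 1" "l \<bullet> (d \<odot> w) = 0"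
    by (rule ex_unit_orthogonal[OF subspaces(2), of "{d \<odot> w}"]) (auto simp: dims)
  obtain m where m: "m \<in> M" "m \<bullet> m = 1" "m \<bullet> (d \<odot> v) = 0"
    by (rule ex_unit_orthogonal[OF subspaces(3), of "{d \<odot> v}"]) (auto simp: dims)
  \<comment> \<open>The angle 0 leaves the last two vectors in place, as \<open>\<theta>\<close> is not yet known.\<close>
  define f where "f = rotated_frame b \<alpha> 0"
  have f: "orthonormal_frame f" unfolding f_def by (rule orthonormal_frame_rotated[OF b])
  have fnth: "f $ 1 = u" "f $ 2 = v" "f $ 3 = w" "f $ 4 = d \<odot> w" "f $ 5 = d \<odot> v" "f $ 6 = v \<odot> z" "f $ 7 = d"
    by (simp_all add: f_def rotated_frame_nth nth dw_eq) (simp add: w \<alpha>)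
  have plane: "x = (x \<bullet> (v \<odot> z)) *\<^sub>R (v \<odot> z) + (x \<bullet> d) *\<^sub>R d"
      "x \<bullet> y = (x \<bullet> (v \<odot> z)) * (y \<bullet> (v \<odot> z)) + (x \<bullet> d) * (y \<bullet> d)"
    if "\<And>y. y \<in> N \<Longrightarrow> x \<bullet> y = 0" "x \<bullet> (d \<odot> w) = 0" "x \<bullet> (d \<odot> v) = 0" for x y
    using orthonormal_frame_expand[OF f card_index, of x] inner_frame_coords[OF f card_index, of x y] that N
    by (simp_all add: sum_7 fnth frame_coords_def inner_vec_def)
  define p where "p = l \<bullet> (v \<odot> z)"
  define q where "q = l \<bullet> d"
  define p' where "p' = m \<bullet> (v \<odot> z)"
  define q' where "q' = m \<bullet> d"
  have lN: "l \<bullet> y = 0" and mN: "m \<bullet> y = 0" if "y \<in> N" for y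
    using perp_NL[OF that l(1)] perp_NM[OF that m(1)] by (simp_all add: inner_commute)
  have l_dv: "l \<bullet> (d \<odot> v) = 0" and m_dw: "m \<bullet> (d \<odot> w) = 0" and lm: "l \<bullet> m = 0"
    using perp_LM[OF l(1) dv] perp_LM[OF dw m(1)] perp_LM[OF l(1) m(1)] by (simp_all add: inner_commute)
  note l_eq = plane[OF lN l(3) l_dv, folded p_def q_def]
  note m_eq = plane[OF mN m_dw m(3), folded p'_def q'_def]
  have pq: "p * p + q * q = 1" "p' * p' + q' * q' = 1" "p * p' + q * q' = 0"
    using l_eq(2)[of l] m_eq(2)[of m] l_eq(2)[of m] l(2) m(2) lm by (simp_all add: p_def q_def p'_def q'_def)
  \<comment> \<open>In the plane, \<open>m\<close> is \<open>l\<close> turned by a right angle, up to the sign \<open>k\<close>.\<close>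
  define k where "k = p * q' - q * p'"
  have k: "k * p' = - q" "k * q' = p" using pq unfolding k_def by algebra+
  have "k *\<^sub>R m = (k * p') *\<^sub>R (v \<odot> z) + (k * q') *\<^sub>R d"
    by (subst m_eq(1)) (simp_all add: scaleR_add_right)
  then have "k *\<^sub>R m = - q *\<^sub>R (v \<odot> z) + p *\<^sub>R d" unfolding k .
  then have m_in: "- q *\<^sub>R (v \<odot> z) + p *\<^sub>R d \<in> M"
    using subspace_scale[OF subspaces(3) m(1), of k] by simp
  have l_in: "p *\<^sub>R (v \<odot> z) + q *\<^sub>R d \<in> L" using l(1) l_eq(1) by simp

  \<comment> \<open>If \<open>\<alpha> = 0\<close>, then \<open>w = u v\<close>, so \<open>N\<close> is closed under the product and \<open>d\<close> lies in \<open>M\<close>.\<close>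
  have q0: "q = 0" if "\<alpha> = 0"
  proof -
    have wa: "w = a" using w \<alpha> that by simp
    have "x \<odot> y \<in> N" if xy: "x \<in> N" "y \<in> N" for x y
    proof -
      have comb: "x = (x \<bullet> u) *\<^sub>R u + (x \<bullet> v) *\<^sub>R v + (x \<bullet> w) *\<^sub>R w" if "x \<in> N" for x
        using orthonormal_frame_expand[OF f card_index, of x] that N_vz[OF that] perp_NL[OF that dw] d(2)[OF that]
        by (simp add: sum_7 fnth inner_commute[of x d])
      have prods: "u \<odot> v = w" "u \<odot> w = - v" "v \<odot> w = u" "v \<odot> u = - w" "w \<odot> u = v" "w \<odot> v = - u"
        using wa mult prd_anticommute[of v u] prd_anticommute[of w u] prd_anticommute[of w v]
        by (simp_all flip: a_def)
      have "x \<odot> y = ((x \<bullet> u) *\<^sub>R u + (x \<bullet> v) *\<^sub>R v + (x \<bullet> w) *\<^sub>R w) \<odot>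
          ((y \<bullet> u) *\<^sub>R u + (y \<bullet> v) *\<^sub>R v + (y \<bullet> w) *\<^sub>R w)"
        using comb[OF xy(1)] comb[OF xy(2)] by simp
      also have "\<dots> \<in> N"
        using N subspaces(1)
        by (simp add: prd_linear prods subspace_add subspace_scale subspace_neg subspace_diff)
      finally show ?thesis .
    qed
    then have "d \<in> M" by (rule closed)
    then show ?thesis using perp_LM[OF l(1)] by (simp add: q_def)
  qed

  have flip: "(- u) \<odot> (- v) = a" "(- u) \<odot> z = - (d \<odot> v)" "(- v) \<odot> z = - (v \<odot> z)"
    by (simp_all add: prd_linear a_def uz)
  have triple': "cayley_triple (\<odot>) (- u, - v, z)"
    using triple by (simp add: cayley_triple_def orthonormal_4 prd_linear)
  \<comment> \<open>The sign \<open>\<epsilon>\<close> of \<open>l\<close> makes its component along \<open>d\<close> nonpositive, as required of \<open>- sin \<theta>\<close>; the sign of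
      the component along \<open>v z\<close> is then adjusted by passing to \<open>(- u, - v)\<close>.\<close>
  obtain \<epsilon> :: real where \<epsilon>: "\<epsilon> = 1 \<or> \<epsilon> = - 1" "0 \<le> - (\<epsilon> * q)"
    by (cases "q \<le> 0") (use that[of 1] that[of "-1"] in auto)
  have pq2: "(\<bar>p\<bar>)\<^sup>2 + (- (\<epsilon> * q))\<^sup>2 = 1"
    using \<epsilon>(1) pq(1) by (auto simp: power2_eq_square)
  then obtain \<theta> where \<theta>: "0 \<le> \<theta>" "\<theta> \<le> pi/2" "\<bar>p\<bar> = cos \<theta>" "- (\<epsilon> * q) = sin \<theta>"
    using sincos_total_pi_half[of "\<bar>p\<bar>" "- (\<epsilon> * q)"] \<epsilon>(2) by auto
  have range: "(\<alpha>, \<theta>) \<in> parameter_range"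
  proof (cases "\<alpha> = 0")
    case True
    then have "sin \<theta> = 0" using q0 \<theta>(4) by simp
    then have "\<theta> = 0" using \<theta>(1,2) sin_gt_zero[of \<theta>] pi_gt_zero by (smt (verit) field_sum_of_halves)
    then show ?thesis using True by (simp add: parameter_range_def)
  next
    case False
    then show ?thesis using \<alpha> \<theta> by (simp add: parameter_range_def)
  qed
  have L_scale: "\<epsilon> *\<^sub>R (p *\<^sub>R (v \<odot> z) + q *\<^sub>R d) \<in> L" and M_scale: "\<epsilon> *\<^sub>R (- q *\<^sub>R (v \<odot> z) + p *\<^sub>R d) \<in> M"
    "- (\<epsilon> *\<^sub>R (- q *\<^sub>R (v \<odot> z) + p *\<^sub>R d)) \<in> M" "- (d \<odot> v) \<in> M"
    using l_in m_in dv subspaces by (auto intro!: subspace_scale subspace_neg)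
  show ?thesis
  proof (cases "0 \<le> \<epsilon> * p")
    case True
    then have "\<epsilon> * p = cos \<theta>" "\<epsilon> * q = - sin \<theta>" using \<theta> \<epsilon>(1) by auto
    then have "adapted u v z \<alpha> \<theta>"
      using triple N(1,2) w_N dw dw_eq dv L_scale M_scale
      unfolding adapted_def a_def[symmetric] az uz
      by (simp add: scaleR_add_right scaleR_diff_right add.commute)
    with range show ?thesis by blast
  next
    case False
    then have "\<epsilon> * p = - cos \<theta>" "\<epsilon> * q = - sin \<theta>" using \<theta> \<epsilon>(1) by auto
    then have "adapted (- u) (- v) z \<alpha> \<theta>"
      using triple' N(1,2) w_N dw dw_eq dv L_scale M_scale subspaces
      unfolding adapted_def flip az
      by (simp add: scaleR_add_right scaleR_diff_right subspace_neg)
    with range show ?thesis by blast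
  qed
qed

lemma ex_adapted: "\<exists>u v z \<alpha> \<theta>. (\<alpha>, \<theta>) \<in> parameter_range \<and> adapted u v z \<alpha> \<theta>"
proof -
  obtain d where d: "d \<bullet> d = 1" "\<And>x. x \<in> N \<Longrightarrow> d \<bullet> x = 0"
    "\<And>x y. x \<in> N \<Longrightarrow> y \<in> N \<Longrightarrow> (x \<odot> y) \<bullet> d = 0"
    "(\<forall>x\<in>N. \<forall>y\<in>N. x \<odot> y \<in> N) \<longrightarrow> d \<in> M"
    using ex_direction by blast
  obtain w where w: "w \<in> N" "w \<bullet> w = 1" "d \<odot> w \<in> L"
    using ex_unit_into_L[OF d(3)] by blast
  obtain v where v: "v \<in> N" "v \<bullet> v = 1" "d \<odot> v \<in> M"
    using eigenspace_decomposition.ex_unit_into_L[OF decomposition_swap d(3)] by blast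
  have vw: "v \<bullet> w = 0"
    using perp_LM[OF w(3) v(3)] d(1) d(2)[OF w(1)] inner_prd_prd_left[of d w v] by (simp add: inner_commute)
  have "card {v, w} < dim N" using card_insert_le_m1[of 2 "{w}" v] by (simp add: dims)
  then obtain u where u: "u \<in> N" "u \<bullet> u = 1" "u \<bullet> v = 0" "u \<bullet> w = 0"
    using ex_unit_orthogonal[OF subspaces(1), of "{v, w}"] by (metis finite.intros insertCI)
  define u' where "u' = (if 0 \<le> (u \<odot> v) \<bullet> w then u else - u)"
  define d' where "d' = (if (d \<odot> (u' \<odot> v)) \<bullet> w \<le> 0 then d else - d)"
  have d'_eq: "d' = d \<or> d' = - d" by (simp add: d'_def)
  show ?thesis
  proof (rule adapted_of_direction)
    show "d' \<bullet> d' = 1" using d(1) d'_eq by auto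
    show "d' \<bullet> x = 0" if "x \<in> N" for x using d(2)[OF that] d'_eq by auto
    show "(x \<odot> y) \<bullet> d' = 0" if "x \<in> N" "y \<in> N" for x y using d(3)[OF that] d'_eq by auto
    show "d' \<in> M" if "\<And>x y. x \<in> N \<Longrightarrow> y \<in> N \<Longrightarrow> x \<odot> y \<in> N"
      using d(4) that d'_eq subspaces(3) by (auto intro: subspace_neg)
    show "u' \<in> N" using u(1) subspaces(1) by (simp add: u'_def subspace_neg)
    show "v \<in> N" "w \<in> N" "v \<bullet> v = 1" "w \<bullet> w = 1" "v \<bullet> w = 0" by (fact v w vw)+
    show "u' \<bullet> u' = 1" "u' \<bullet> v = 0" "u' \<bullet> w = 0" using u by (simp_all add: u'_def)
    show "d' \<odot> w \<in> L" "d' \<odot> v \<in> M"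
      using w(3) v(3) d'_eq subspaces by (auto simp: prd_linear intro: subspace_neg)
    show "0 \<le> (u' \<odot> v) \<bullet> w" by (simp add: u'_def prd_linear)
    show "(d' \<odot> (u' \<odot> v)) \<bullet> w \<le> 0" by (simp add: d'_def prd_linear)
  qed
qed

end

context vector_product_space_7
begin

lemma ex_normal_form:
  assumes \<delta>: "\<delta> \<in> sym_endo" and ne: "lam \<noteq> \<mu>" "lam \<noteq> \<nu>" "\<mu> \<noteq> \<nu>"
    and dims: "dim {x. \<delta> x = lam *\<^sub>R x} = 2" "dim {x. \<delta> x = \<mu> *\<^sub>R x} = 2" "dim {x. \<delta> x = \<nu> *\<^sub>R x} = 3"
  obtains t \<alpha> \<theta> where "cayley_triple (\<odot>) t" "(\<alpha>, \<theta>) \<in> parameter_range"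
    "matrix_in_basis (cayley_basis (\<odot>) t) \<delta> = normal_form lam \<mu> \<nu> \<alpha> \<theta>"
proof -
  let ?E = "\<lambda>l. {x. \<delta> x = l *\<^sub>R x}"
  have lin: "linear \<delta>" and sym: "\<delta> x \<bullet> y = x \<bullet> \<delta> y" for x y
    using \<delta> by (simp_all add: sym_endo_def)
  have perp: "x \<bullet> y = 0" if "x \<in> ?E l" "y \<in> ?E k" "l \<noteq> k" for x y l k
    using sym[of x y] that by simp
  have sub: "subspace (?E l)" for l
    using lin by (auto simp: subspace_def linear_0 linear_add linear_scale algebra_simps)
  interpret eigenspace_decomposition prd "?E \<nu>" "?E lam" "?E \<mu>"
  proof unfold_locales
    show "x \<bullet> y = 0" if "x \<in> ?E \<nu>" "y \<in> ?E lam" for x y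
      by (rule perp[OF that]) (use ne in auto)
    show "x \<bullet> y = 0" if "x \<in> ?E \<nu>" "y \<in> ?E \<mu>" for x y
      by (rule perp[OF that]) (use ne in auto)
    show "x \<bullet> y = 0" if "x \<in> ?E lam" "y \<in> ?E \<mu>" for x y
      by (rule perp[OF that]) (use ne in auto)
  qed (fact sub dims)+
  obtain u v z \<alpha> \<theta> where range: "(\<alpha>, \<theta>) \<in> parameter_range" and ad: "adapted u v z \<alpha> \<theta>"
    using ex_adapted by blast
  then have triple: "cayley_triple (\<odot>) (u, v, z)" by (simp add: adapted_def)
  have "matrix_in_basis (cayley_basis (\<odot>) (u, v, z)) \<delta> = normal_form lam \<mu> \<nu> \<alpha> \<theta>"
    using ad unfolding matrix_eq_normal_form_iff[OF orthonormal_frame_cayley_basis[OF triple] dim_7 lin]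
      forall_7 rotated_frame_nth frame_eigenvalues_nth cayley_basis_nth adapted_def by blast
  with triple range show thesis by (rule that)
qed

end

section \<open>The cross-section\<close>

theorem proposition3p7:
  fixes prd :: "'a::euclidean_space \<Rightarrow> 'a \<Rightarrow> 'a"
    and s :: "'a \<times> 'a \<times> 'a"
    and lam \<mu> \<nu> :: real
  assumes "DIM('a) = 7"
    and "vector_product prd"
    and "cayley_triple prd s"
    and "lam \<noteq> \<mu>" and "lam \<noteq> \<nu>" and "\<mu> \<noteq> \<nu>"
  shows "cross_section prd s {(lam, 2), (\<mu>, 2), (\<nu>, 3)}
    {block_diag (\<nu> *\<^sub>R mat 1)
        (matrix_inv (rot \<alpha>) ** diag2 \<nu> lam ** rot \<alpha>)
        \<mu>
        (matrix_inv (rot \<theta>) ** diag2 lam \<mu> ** rot \<theta>) | \<alpha> \<theta>.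
      (\<alpha>, \<theta>) \<in> {0<..pi/2} \<times> {0..pi/2} \<union> {(0, 0)}}"
  unfolding normal_form_def[symmetric] parameter_range_def[symmetric]
proof -
  interpret vector_product_space_7 prd
    using assms by unfold_locales
  note ne = assms(4-6)
  let ?p = "{(lam, 2), (\<mu>, 2), (\<nu>, 3)} :: (real \<times> nat) set"
  let ?C = "{normal_form lam \<mu> \<nu> \<alpha> \<theta> | \<alpha> \<theta>. (\<alpha>, \<theta>) \<in> parameter_range}"
  define b where "b = cayley_basis prd s"
  have b: "orthonormal_frame b"
    unfolding b_def by (rule orthonormal_frame_cayley_basis[OF assms(3)])
  have sub: "?C \<subseteq> Sym ?p" using normal_form_in_Sym[OF b dim_7 ne] by blast
  have one: "\<exists>!K. K \<in> ?C \<inter> G2_orbit prd s K0" if K0: "K0 \<in> Sym ?p" for K0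
  proof -
    obtain \<delta> where \<delta>: "\<delta> \<in> sym_endo" "matrix_in_basis b \<delta> = K0"
      using ex_sym_endo_of_matrix[OF b dim_7, of K0] K0 by (auto simp: Sym_def)
    then have lin: "linear \<delta>" by (simp add: sym_endo_def)
    have orbit: "G2_orbit prd s K0 = {matrix_in_basis (cayley_basis prd t) \<delta> | t. cayley_triple prd t}"
      using G2_orbit_eq[OF assms(3) \<delta>(1)] \<delta>(2) by (simp add: b_def)
    have "dim (eigenspace K0 l) = k" if "(l, k) \<in> ?p" for l k
    proof -
      have "(l, k) \<in> eigen_dims K0" using that K0 by (simp add: Sym_def)
      then show ?thesis by (auto simp: eigen_dims_def)
    qed
    then have dims: "dim {x. \<delta> x = l *\<^sub>R x} = k" if "(l, k) \<in> ?p" for l k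
      using that matrix_in_basis_eigenspace(1)[OF b dim_7 lin, of l] \<delta>(2) by simp
    obtain t \<alpha> \<theta> where t: "cayley_triple prd t" "(\<alpha>, \<theta>) \<in> parameter_range"
      "matrix_in_basis (cayley_basis prd t) \<delta> = normal_form lam \<mu> \<nu> \<alpha> \<theta>"
      by (rule ex_normal_form[OF \<delta>(1) ne]) (auto intro: dims)
    show ?thesis
    proof (rule ex1I)
      show "normal_form lam \<mu> \<nu> \<alpha> \<theta> \<in> ?C \<inter> G2_orbit prd s K0"
      proof (rule IntI)
        show "normal_form lam \<mu> \<nu> \<alpha> \<theta> \<in> ?C" using t(2) by blast
        show "normal_form lam \<mu> \<nu> \<alpha> \<theta> \<in> G2_orbit prd s K0"
          unfolding orbit t(3)[symmetric] using t(1) by blast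
      qed
    next
      fix K assume "K \<in> ?C \<inter> G2_orbit prd s K0"
      then obtain t' \<alpha>' \<theta>' where t': "cayley_triple prd t'" "(\<alpha>', \<theta>') \<in> parameter_range"
        "matrix_in_basis (cayley_basis prd t') \<delta> = normal_form lam \<mu> \<nu> \<alpha>' \<theta>'"
        "K = normal_form lam \<mu> \<nu> \<alpha>' \<theta>'"
        unfolding orbit by auto
      show "K = normal_form lam \<mu> \<nu> \<alpha> \<theta>"
        unfolding t'(4) normal_form_parameters_unique[OF lin ne t'(1,3) t(1,3) t'(2) t(2)] ..
    qed
  qed
  show "cross_section prd s ?p ?C"
    unfolding cross_section_def
  proof (intro conjI ballI)
    fix orb assume "orb \<in> G2_orbit prd s ` Sym ?p"
    then obtain K0 where "orb = G2_orbit prd s K0" "K0 \<in> Sym ?p" by (rule imageE)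
    then show "\<exists>!K. K \<in> ?C \<inter> orb" using one by simp
  qed (rule sub)
qed

end
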